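(* Assume $M\ge N$, and let the channel matrices $\mathbf H_k\in\mathbb R^{N\times M}$ and $\mathbf G_k\in\mathbb R^{M\times N}$ ($k\in\mathcal I_K$) be fixed and of full rank. Set $P_k=\beta_kP$ ($k\in\mathcal I_K$), $P_{\mathrm R,n}=\beta_{\mathrm R}P$ ($n\in\mathcal I_N$), and $\sigma_k^2=\sigma_{\mathrm R}^2=\sigma^2$ for all $k$, where $\beta_1,\dots,\beta_K,\beta_{\mathrm R}>0$ and $\sigma^2>0$ are fixed constants. If $\alpha\in(0,\tfrac12)\cup(\tfrac12,1)$, then $$\lim_{P/\sigma^2\to\infty}\big(R_{\mathrm{coop}}-R_{\mathrm{dist}}\big)=0.$$
   Context: Notation: $\mathcal I_L=\{1,\dots,L\}$; $[x]^+=\max\{x,0\}$; logarithms are base 2. Given $\mathbf H_k$, let $\mathbf H_k=\mathbf R_k\mathbf U_k$ be an RQ decomposition with $\mathbf R_k\in\mathbb R^{N\times N}$ upper triangular and $\mathbf U_k\mathbf U_k^{\mathrm T}=\mathbf I_N$, and let $r_k(n,n)$ be the $(n,n)$ entry of $\mathbf R_k$. Let $\mathbf g_{n,k}$ denote the $n$-th column of $\mathbf G_k$. $K\ge 2$, $\alpha\in(0,1)$. $R_{\mathrm{dist}}$ is the optimal value of: maximize $\sum_{k=1}^K\sum_{n=1}^N R_{k,n}$ over $P_{k,n}\ge0$, $R_{k,n}\ge 0$ subject to (i) $R_{k,n}\le\frac{1}{K-1}\left[\frac{\alpha}{2}\log\frac{|r_k(n,n)|^2P_{k,n}}{\sigma_{\mathrm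 R}^2}\right]^+$ for all $k\in\mathcal I_K,n\in\mathcal I_N$; (ii) $\sum_{n\in\mathcal S}\sum_{k'\in\mathcal I_K\setminus\{k\}}R_{k',n}\le\frac{1-\alpha}{2}\log\left|\mathbf I_M+\frac{1}{\sigma_k^2}\sum_{n\in\mathcal S}P_{\mathrm R,n}\mathbf g_{n,k}\mathbf g_{n,k}^{\mathrm T}\right|$ for all $k\in\mathcal I_K$ and all $\mathcal S\subseteq\mathcal I_N$; (iii) $\frac{2}{K-1}\sum_{n=1}^N P_{k,n}\le P_k$ for $k=2,\dots,K-1$, and $\frac{1}{K-1}\sum_{n=1}^NP_{k,n}\le P_k$ for $k\in\{1,K\}$. $R_{\mathrm{coop}}$ is the optimal value of: maximize $\sum_{k=1}^K R_k$ over a positive semidefinite $\mathbf Q_{\mathrm R}\in\mathbb R^{N\times N}$, $P_{k,n}\ge 0$ and $R_k\ge 0$ subject to (i') $R_k\le\frac{1}{K-1}\sum_{n=1}^N\left[\frac{\alpha}{2}\log\frac{|r_k(n,n)|^2P_{k,n}}{\sigma_{\mathrm R}^2}\right]^+$ for all $k\in\mathcal I_K$; (ii') $\sum_{k'\in\mathcal I_K\setminus\{k\}}R_{k'}\le\frac{1-\alpha}{2}\log\left|\mathbf I_M+\frac{1}{\sigma_k^2}\mathbf G_k\mathbf Q_{\mathrm R}\mathbf G_k^{\mathrm T}\right|$ for all $k\in\mathcal I_K$; (iii') $\mathrm{tr}(\mathbf Q_{\mathrm R})\le\sum_{n=1}^NP_{\mathrm R,n}$; and the same power constraints (iii) on $P_{k,n}$.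 *)

theory Defs
  imports "HOL-Analysis.Analysis"
begin

definition outer :: "real^'m \<Rightarrow> real^'m^'m" where
  "outer g = (\<chi> i j. g $ i * g $ j)"

definition psd :: "((real, 'n::finite) vec, 'n) vec \<Rightarrow> bool" where
  "psd Q \<longleftrightarrow> transpose Q = Q \<and> (\<forall>x. 0 \<le> x \<bullet> (Q *v x))"

definition upper_triangular :: "((real, 'n::{finite,linorder}) vec, 'n) vec \<Rightarrow> bool" where
  "upper_triangular R \<longleftrightarrow> (\<forall>i j. j < i \<longrightarrow> R $ i $ j = 0)"

definition src_power_ok :: "nat \<Rightarrow> (nat \<Rightarrow> real) \<Rightarrow> (nat \<Rightarrow> 'n::finite \<Rightarrow> real) \<Rightarrow> bool" where
  "src_power_ok K Pk P \<longleftrightarrow>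
     (\<forall>k\<in>{1..K}. \<forall>n. 0 \<le> P k n) \<and>
     (\<forall>k\<in>{2..K-1}. 2 / (real K - 1) * (\<Sum>n\<in>UNIV. P k n) \<le> Pk k) \<and>
     (\<forall>k\<in>{1, K}. 1 / (real K - 1) * (\<Sum>n\<in>UNIV. P k n) \<le> Pk k)"

(* Feasible set of the distributed problem.
   r k = R_k (the R factor of the RQ decomposition of H_k), G k = G_k,
   Pk k = P_k, PR n = P_{R,n}, sk k = sigma_k^2, sR = sigma_R^2. *)
definition dist_feasible ::
  "nat \<Rightarrow> real \<Rightarrow> (nat \<Rightarrow> ((real, 'n::{finite,linorder}) vec, 'n) vec) \<Rightarrow> (nat \<Rightarrow> ((real, 'n) vec, 'm::finite) vec)
   \<Rightarrow> (nat \<Rightarrow> real) \<Rightarrow> ('n \<Rightarrow> real) \<Rightarrow> (nat \<Rightarrow> real) \<Rightarrow> real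
   \<Rightarrow> (nat \<Rightarrow> 'n \<Rightarrow> real) \<Rightarrow> (nat \<Rightarrow> 'n \<Rightarrow> real) \<Rightarrow> bool" where
  "dist_feasible K \<alpha> r G Pk PR sk sR P R \<longleftrightarrow>
     (\<forall>k\<in>{1..K}. \<forall>n. 0 \<le> R k n \<and>
        R k n \<le> 1 / (real K - 1) *
          max (\<alpha> / 2 * log 2 (\<bar>r k $ n $ n\<bar>^2 * P k n / sR)) 0) \<and>
     (\<forall>k\<in>{1..K}. \<forall>S::'n set.
        (\<Sum>n\<in>S. \<Sum>k'\<in>{1..K} - {k}. R k' n) \<le>
          (1 - \<alpha>) / 2 * log 2 (det (mat 1 + (1 / sk k) *\<^sub>R
                 (\<Sum>n\<in>S. PR n *\<^sub>R outer (column n (G k)))))) \<and>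
     src_power_ok K Pk P"

definition R_dist ::
  "nat \<Rightarrow> real \<Rightarrow> (nat \<Rightarrow> ((real, 'n::{finite,linorder}) vec, 'n) vec) \<Rightarrow> (nat \<Rightarrow> ((real, 'n) vec, 'm::finite) vec)
   \<Rightarrow> (nat \<Rightarrow> real) \<Rightarrow> ('n \<Rightarrow> real) \<Rightarrow> (nat \<Rightarrow> real) \<Rightarrow> real \<Rightarrow> real" where
  "R_dist K \<alpha> r G Pk PR sk sR =
     Sup {(\<Sum>k\<in>{1..K}. \<Sum>n\<in>UNIV. R k n) | P R. dist_feasible K \<alpha> r G Pk PR sk sR P R}"

definition coop_feasible ::
  "nat \<Rightarrow> real \<Rightarrow> (nat \<Rightarrow> ((real, 'n::{finite,linorder}) vec, 'n) vec) \<Rightarrow> (nat \<Rightarrow> ((real, 'n) vec, 'm::finite) vec)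
   \<Rightarrow> (nat \<Rightarrow> real) \<Rightarrow> ('n \<Rightarrow> real) \<Rightarrow> (nat \<Rightarrow> real) \<Rightarrow> real
   \<Rightarrow> ((real, 'n) vec, 'n) vec \<Rightarrow> (nat \<Rightarrow> 'n \<Rightarrow> real) \<Rightarrow> (nat \<Rightarrow> real) \<Rightarrow> bool" where
  "coop_feasible K \<alpha> r G Pk PR sk sR Q P R \<longleftrightarrow>
     psd Q \<and>
     (\<forall>k\<in>{1..K}. 0 \<le> R k \<and>
        R k \<le> 1 / (real K - 1) *
          (\<Sum>n\<in>UNIV. max (\<alpha> / 2 * log 2 (\<bar>r k $ n $ n\<bar>^2 * P k n / sR)) 0)) \<and>
     (\<forall>k\<in>{1..K}.
        (\<Sum>k'\<in>{1..K} - {k}. R k') \<le>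
          (1 - \<alpha>) / 2 * log 2 (det (mat 1 + (1 / sk k) *\<^sub>R (G k ** Q ** transpose (G k))))) \<and>
     trace Q \<le> (\<Sum>n\<in>UNIV. PR n) \<and>
     src_power_ok K Pk P"

definition R_coop ::
  "nat \<Rightarrow> real \<Rightarrow> (nat \<Rightarrow> ((real, 'n::{finite,linorder}) vec, 'n) vec) \<Rightarrow> (nat \<Rightarrow> ((real, 'n) vec, 'm::finite) vec)
   \<Rightarrow> (nat \<Rightarrow> real) \<Rightarrow> ('n \<Rightarrow> real) \<Rightarrow> (nat \<Rightarrow> real) \<Rightarrow> real \<Rightarrow> real" where
  "R_coop K \<alpha> r G Pk PR sk sR =
     Sup {(\<Sum>k\<in>{1..K}. R k) | Q P R. coop_feasible K \<alpha> r G Pk PR sk sR Q P R}"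

end

theory Submission
  imports Defs
begin

text \<open>
  With \<open>x = \<beta>R P / \<sigma>\<^sup>2\<close>, let \<open>L\<^sub>k = log det (I + x G\<^sub>k G\<^sub>k\<^sup>T)\<close>. The choice \<open>Q\<^sub>R = \<beta>R P I\<close> shows that
  \<open>R_dist \<le> R_coop\<close>.

  For \<open>\<alpha> < 1/2\<close> only the source constraints bind at high power: every subset constraint of the relay
  is of order \<open>|S| (1-\<alpha>)/2 log P\<close>, while the sources deliver \<open>|S| \<alpha>/2 log P\<close>; so each cooperative
  solution is matched by a distributed one.

  For \<open>\<alpha> > 1/2\<close> the relay constraints bind. Concavity of log det gives
  \<open>log det (I + G\<^sub>k Q G\<^sub>k\<^sup>T) \<le> L\<^sub>k + O(1/x)\<close> whenever \<open>tr Q \<le> N x\<close>, so the cooperative sum rate is at most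
  \<open>(1-\<alpha>)/(2(K-1)) \<Sum>\<^sub>k L\<^sub>k + O(1/P)\<close>. The set function \<open>S \<mapsto> log det (I + x \<Sum>\<^sub>S g\<^sub>n g\<^sub>n\<^sup>T)\<close> is submodular,
  so its increments \<open>f k n\<close> along the chain of initial segments satisfy all subset constraints and sum up
  to \<open>L\<^sub>k\<close>. Solving \<open>\<Sum>k'\<noteq>k. R k' n = (1-\<alpha>)/2 f k n\<close> for \<open>R\<close> then gives a feasible distributed solution with
  sum rate \<open>(1-\<alpha>)/(2(K-1)) \<Sum>\<^sub>k L\<^sub>k\<close>.
\<close>

section \<open>Positive definite matrices\<close>

definition posdef :: "real^'n^'n \<Rightarrow> bool" where
  "posdef C \<longleftrightarrow> transpose C = C \<and> (\<forall>x. x \<noteq> 0 \<longrightarrow> 0 < x \<bullet> (C *v x))"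

lemma matrix_add_rdistrib:
  fixes A B :: "'a::semiring_1^'n^'m"
  shows "(A + B) ** C = A ** C + B ** C"
  by (simp add: vec_eq_iff matrix_matrix_mult_def distrib_right sum.distrib)

lemma inner_matrix_vector:
  fixes A :: "real^'n^'m"
  shows "x \<bullet> (A *v y) = (transpose A *v x) \<bullet> y"
  using dot_lmul_matrix[of x A y] by simp

lemma invertible_iff_kernel_trivial:
  fixes A :: "real^'n^'n"
  shows "invertible A \<longleftrightarrow> (\<forall>x. A *v x = 0 \<longrightarrow> x = 0)"
  using invertible_left_inverse[of A] matrix_left_invertible_ker[of A] by simp

lemma posdef_invertible: "posdef C \<Longrightarrow> invertible C"
  unfolding invertible_iff_kernel_trivial posdef_def by (metis inner_zero_right less_irrefl)

lemma posdef_congruence: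
  fixes C T :: "real^'n^'n"
  assumes "posdef C" "det T \<noteq> 0"
  shows "posdef (T ** C ** transpose T)"
proof -
  have inv: "invertible (transpose T)"
    using assms by (simp add: invertible_det_nz)
  have "0 < x \<bullet> (T ** C ** transpose T *v x)" if "x \<noteq> 0" for x
  proof -
    have "transpose T *v x \<noteq> 0"
      using inv that unfolding invertible_iff_kernel_trivial by blast
    then have "0 < (transpose T *v x) \<bullet> (C *v (transpose T *v x))"
      using assms unfolding posdef_def by blast
    then show ?thesis
      by (simp add: inner_matrix_vector[of x T] flip: matrix_vector_mul_assoc matrix_mul_assoc)
  qed
  moreover have "transpose (T ** C ** transpose T) = T ** C ** transpose T"
    using assms by (simp add: posdef_def matrix_transpose_mul matrix_mul_assoc)
  ultimately show ?thesis by (simp add: posdef_def)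
qed

lemma posdef_diagonal_pos:
  assumes "posdef C" shows "0 < C $ i $ i"
proof -
  have "axis i (1::real) \<noteq> 0" by (simp add: axis_eq_0_iff)
  then have "0 < axis i 1 \<bullet> (C *v axis i 1)" using assms unfolding posdef_def by blast
  then show ?thesis by (simp add: inner_axis' matrix_vector_mult_basis column_def)
qed

text \<open>The matrix is the identity with column \<open>k\<close> replaced by
  \<open>u + axis k 1\<close>, so Cramer's rule for the identity reads off entry \<open>k\<close> of
  that column.\<close>

lemma det_add_column:
  fixes u :: "real^'n"
  shows "det (mat 1 + (\<chi> i j. u $ i * axis k 1 $ j)) = 1 + u $ k"
proof -
  have "mat 1 + (\<chi> i j. u $ i * axis k 1 $ j) =
     (\<chi> i j. if j = k then (mat 1 *v (u + axis k 1)) $ i else (mat 1 :: real^'n^'n) $ i $ j)"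
    by (simp only: matrix_vector_mul_lid) (simp add: vec_eq_iff mat_def axis_def)
  then show ?thesis
    by (simp only: cramer_lemma) (simp add: axis_def)
qed

text \<open>The matrix determinant lemma at the identity. An invertible \<open>Y\<close> whose row
  \<open>k\<close> is \<open>v\<close> intertwines the update with one that changes only column
  \<open>k\<close>, where \<open>det_add_column\<close> applies.\<close>

lemma det_rank_one_update:
  fixes u v :: "real^'n"
  shows "det (mat 1 + (\<chi> i j. u $ i * v $ j)) = 1 + u \<bullet> v"
proof (cases "v = 0")
  case True
  then show ?thesis by (simp add: zero_vec_def[symmetric])
next
  case False
  then obtain k where k: "v $ k \<noteq> 0" by (auto simp: vec_eq_iff)
  \<comment> \<open>\<open>X\<close> is the identity with column \<open>k\<close> replaced by
    \<open>v\<close>. Its transpose \<open>Y\<close> then has \<open>v\<close> as row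
    \<open>k\<close>, and its determinant \<open>v $ k\<close> is nonzero by the choice of
    \<open>k\<close>.\<close>
  define X :: "real^'n^'n" where "X = mat 1 + (\<chi> i j. (v - axis k 1) $ i * axis k 1 $ j)"
  define Y where "Y = transpose X"
  have dX: "det Y = v $ k" by (simp only: X_def Y_def det_transpose det_add_column) (simp add: axis_def)
  have Yij: "Y $ i $ j = (if i = k then v $ j else if i = j then 1 else 0)" for i j
    by (auto simp: Y_def X_def transpose_def mat_def axis_def)
  have row_k: "(Y *v u) $ k = u \<bullet> v"
    by (simp add: matrix_vector_mult_def Yij inner_vec_def mult.commute)
  have "Y ** (mat 1 + (\<chi> i j. u $ i * v $ j)) = (mat 1 + (\<chi> i j. (Y *v u) $ i * axis k 1 $ j)) ** Y"
  proof -
    have "Y ** (\<chi> i j. u $ i * v $ j) = (\<chi> i j. (Y *v u) $ i * v $ j)"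
      by (simp add: vec_eq_iff matrix_matrix_mult_def matrix_vector_mult_def sum_distrib_right mult.assoc)
    moreover have "(\<chi> i j. (Y *v u) $ i * axis k 1 $ j) ** Y = (\<chi> i j. (Y *v u) $ i * v $ j)"
    proof -
      have "(\<Sum>a\<in>UNIV. (Y *v u) $ i * axis k 1 $ a * Y $ a $ j) = (Y *v u) $ i * v $ j" for i j
      proof -
        have "(\<Sum>a\<in>UNIV. (Y *v u) $ i * axis k 1 $ a * Y $ a $ j)
          = (\<Sum>a\<in>UNIV. if a = k then (Y *v u) $ i * v $ j else 0)"
          by (intro sum.cong) (auto simp: axis_def Yij)
        then show ?thesis by simp
      qed
      then show ?thesis by (simp add: vec_eq_iff matrix_matrix_mult_def)
    qed
    ultimately show ?thesis by (simp add: matrix_add_ldistrib matrix_add_rdistrib)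
  qed
  then have "det Y * det (mat 1 + (\<chi> i j. u $ i * v $ j)) = (1 + u \<bullet> v) * det Y"
    by (metis det_mul det_add_column row_k)
  then show ?thesis using k dX by simp
qed

text \<open>Symmetric Gaussian elimination with positive pivots. Besides diagonalizing, it never
  raises a diagonal entry, which is what Hadamard's inequality needs.\<close>

lemma congruence_diagonalization:
  fixes C :: "real^'n^'n"
  assumes "posdef C"
  shows "\<exists>T. det T = 1 \<and> (\<forall>i j. i \<noteq> j \<longrightarrow> (T ** C ** transpose T) $ i $ j = 0) \<and>
    (\<forall>i. (T ** C ** transpose T) $ i $ i \<le> C $ i $ i)"
proof -
  \<comment> \<open>Induction over the set \<open>S\<close> of pivots already processed: only the
    rows in \<open>S\<close> have been cleared so far.\<close>
  have "\<exists>T. det T = 1 \<and> (\<forall>i\<in>S. \<forall>j. i \<noteq> j \<longrightarrow> (T ** C ** transpose T) $ i $ j = 0) \<and>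
    (\<forall>i. (T ** C ** transpose T) $ i $ i \<le> C $ i $ i)" for S :: "'n set"
  proof (induction S rule: finite_induct[OF finite])
    case 1
    show ?case by (intro exI[of _ "mat 1"]) simp
  next
    case (2 k S)
    then obtain T where T: "det T = 1"
      "\<And>i j. i \<in> S \<Longrightarrow> i \<noteq> j \<Longrightarrow> (T ** C ** transpose T) $ i $ j = 0"
      "\<And>i. (T ** C ** transpose T) $ i $ i \<le> C $ i $ i" by blast
    define D where "D = T ** C ** transpose T"
    have pd: "posdef D" unfolding D_def using assms T by (intro posdef_congruence) auto
    have sym: "D $ i $ j = D $ j $ i" for i j
      using pd unfolding posdef_def by (metis transpose_def vec_lambda_beta)
    have Dkk: "D $ k $ k > 0" using posdef_diagonal_pos[OF pd] .
    \<comment> \<open>Elimination multipliers: adding \<open>u $ i\<close> times row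
      \<open>k\<close> to row \<open>i\<close>, and likewise for columns, clears column
      \<open>k\<close> off the pivot. The value 0 at \<open>k\<close> keeps the pivot.\<close>
    define u :: "real^'n" where "u = (\<chi> i. if i = k then 0 else - (D $ i $ k / D $ k $ k))"
    define V :: "real^'n^'n" where "V = mat 1 + (\<chi> i j. u $ i * axis k 1 $ j)"
    have V: "V $ i $ a = (if a = i then 1 else 0) + (if a = k then u $ i else 0)" for i a
      by (auto simp: V_def mat_def axis_def)
    have ent: "(V ** D ** transpose V) $ i $ j
       = D $ i $ j + u $ i * D $ k $ j + u $ j * (D $ i $ k + u $ i * D $ k $ k)" for i j
    proof -
      have "(V ** D) $ i $ b = D $ i $ b + u $ i * D $ k $ b" for b
      proof -
        have "(V ** D) $ i $ b = (\<Sum>a\<in>UNIV. (if a = i then D $ i $ b else 0) + (if a = k then u $ i * D $ k $ b else 0))"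
          unfolding matrix_matrix_mult_def by (auto intro!: sum.cong simp: V distrib_right)
        then show ?thesis by (simp add: sum.distrib)
      qed
      moreover have "(V ** D ** transpose V) $ i $ j
        = (\<Sum>b\<in>UNIV. (if b = j then (V ** D) $ i $ j else 0) + (if b = k then (V ** D) $ i $ k * u $ j else 0))"
        unfolding matrix_matrix_mult_def[of "V ** D"] by (auto intro!: sum.cong simp: V transpose_def distrib_left)
      ultimately show ?thesis by (simp add: sum.distrib)
    qed
    have eq: "V ** T ** C ** transpose (V ** T) = V ** D ** transpose V"
      by (simp add: D_def matrix_transpose_mul matrix_mul_assoc)
    show ?case
    proof (intro exI[of _ "V ** T"] conjI ballI allI impI)
      show "det (V ** T) = 1"
        using T(1) unfolding det_mul V_def det_add_column by (simp add: u_def)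
    next
      fix i j assume i: "i \<in> insert k S" "i \<noteq> j"
      show "(V ** T ** C ** transpose (V ** T)) $ i $ j = 0"
      proof (cases "i = k")
        case True
        then show ?thesis using i Dkk sym[of k j] by (simp add: eq ent u_def)
      next
        case False
        \<comment> \<open>A row cleared earlier has multiplier 0, so the new pivot leaves it
          clear.\<close>
        then have "D $ i $ k = 0" "D $ i $ j = 0" using i T(2) by (auto simp: D_def)
        then show ?thesis using False by (simp add: eq ent u_def)
      qed
    next
      fix i
      \<comment> \<open>For \<open>i \<noteq> k\<close> the diagonal entry drops by
        \<open>(D $ i $ k)^2 / D $ k $ k\<close>.\<close>
      have "(V ** D ** transpose V) $ i $ i \<le> D $ i $ i"
        using Dkk sym[of k i] by (simp add: ent u_def)
      then show "(V ** T ** C ** transpose (V ** T)) $ i $ i \<le> C $ i $ i"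
        using T(3)[of i] by (simp add: eq D_def)
    qed
  qed
  from this[of UNIV] show ?thesis by auto
qed

text \<open>The second part is Hadamard's inequality: the unimodular diagonalization keeps the
  determinant and can only lower the diagonal.\<close>

lemma posdef_det_pos_le:
  fixes C :: "real^'n^'n"
  assumes "posdef C"
  shows "0 < det C" "det C \<le> (\<Prod>i\<in>UNIV. C $ i $ i)"
proof -
  obtain T where T: "det T = 1" "\<And>i j. i \<noteq> j \<Longrightarrow> (T ** C ** transpose T) $ i $ j = 0"
    "\<And>i. (T ** C ** transpose T) $ i $ i \<le> C $ i $ i"
    using congruence_diagonalization[OF assms] by blast
  have "posdef (T ** C ** transpose T)" using assms T by (intro posdef_congruence) auto
  note pos = posdef_diagonal_pos[OF this]
  have "det C = det (T ** C ** transpose T)" using T(1) by (simp add: det_mul)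
  also have "\<dots> = (\<Prod>i\<in>UNIV. (T ** C ** transpose T) $ i $ i)"
    using T(2) by (rule det_diagonal)
  finally have eq: "det C = \<dots>" .
  show "0 < det C" unfolding eq using pos by (intro prod_pos) auto
  show "det C \<le> (\<Prod>i\<in>UNIV. C $ i $ i)" unfolding eq using pos T(3) by (intro prod_mono) (auto intro: less_imp_le)
qed

lemma posdef_imp_psd: "posdef C \<Longrightarrow> psd C"
  unfolding posdef_def psd_def by (metis inner_zero_left less_imp_le order_refl)

lemma psd_congruence:
  fixes Q :: "real^'n^'n" and V :: "real^'n^'m"
  assumes "psd Q"
  shows "psd (V ** Q ** transpose V)"
proof -
  have "0 \<le> x \<bullet> (V ** Q ** transpose V *v x)" for x
  proof -
    have "0 \<le> (transpose V *v x) \<bullet> (Q *v (transpose V *v x))"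
      using assms unfolding psd_def by blast
    then show ?thesis
      by (simp add: inner_matrix_vector[of x V] flip: matrix_vector_mul_assoc matrix_mul_assoc)
  qed
  moreover have "transpose (V ** Q ** transpose V) = V ** Q ** transpose V"
    using assms by (simp add: psd_def matrix_transpose_mul matrix_mul_assoc)
  ultimately show ?thesis by (simp add: psd_def)
qed

lemma psd_diagonal_nonneg:
  assumes "psd C" shows "0 \<le> C $ i $ i"
proof -
  have "0 \<le> axis i 1 \<bullet> (C *v axis i 1)" using assms unfolding psd_def by blast
  then show ?thesis by (simp add: inner_axis' matrix_vector_mult_basis column_def)
qed

lemma matrix_inv_inverse:
  fixes A :: "real^'n^'n"
  assumes "invertible A"
  shows "A ** matrix_inv A = mat 1" "matrix_inv A ** A = mat 1"
  using assms unfolding invertible_def matrix_inv_def by (metis (mono_tags, lifting) someI_ex)+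

text \<open>Congruence of \<open>C\<close> by its own inverse yields the transposed inverse, which
  is therefore positive definite and in particular symmetric.\<close>

lemma posdef_inverse:
  fixes C :: "real^'n^'n"
  assumes "posdef C"
  shows "posdef (matrix_inv C)"
proof -
  let ?I = "matrix_inv C"
  note inv = matrix_inv_inverse[OF posdef_invertible[OF assms]]
  have "det ?I * det C = 1" by (metis det_I det_mul inv(2))
  then have "det ?I \<noteq> 0" by auto
  then have "posdef (?I ** C ** transpose ?I)" by (intro posdef_congruence assms)
  then have pd: "posdef (transpose ?I)" by (simp add: inv)
  then show ?thesis unfolding posdef_def by (metis transpose_transpose)
qed

text \<open>Diagonalizing \<open>Y\<close> by congruence and cycling the factors turns the trace
  into a sum of products of nonnegative diagonal entries.\<close>

lemma trace_psd_posdef_nonneg: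
  fixes Q Y :: "real^'n^'n"
  assumes Q: "psd Q" and Y: "posdef Y"
  shows "0 \<le> trace (Q ** Y)"
proof -
  obtain T where T: "det T = 1" "\<And>i j. i \<noteq> j \<Longrightarrow> (T ** Y ** transpose T) $ i $ j = 0"
    using congruence_diagonalization[OF Y] by blast
  define D where "D = T ** Y ** transpose T"
  have "posdef D" unfolding D_def using Y T by (intro posdef_congruence) auto
  note pos = posdef_diagonal_pos[OF this]
  have "invertible T" using T by (simp add: invertible_det_nz)
  note inv = matrix_inv_inverse[OF this]
  let ?S = "matrix_inv T"
  have "?S ** D ** transpose ?S = (?S ** T) ** Y ** transpose (?S ** T)"
    unfolding D_def by (simp only: matrix_mul_assoc matrix_transpose_mul)
  then have Y_eq: "Y = ?S ** D ** transpose ?S"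
    by (simp add: inv)
  define Q' where "Q' = transpose ?S ** Q ** ?S"
  have "psd Q'" using psd_congruence[OF Q, of "transpose ?S"] by (simp add: Q'_def)
  note pos' = psd_diagonal_nonneg[OF this]
  have "trace (Q ** Y) = trace ((Q ** ?S ** D) ** transpose ?S)"
    by (simp add: Y_eq matrix_mul_assoc)
  also have "\<dots> = trace (transpose ?S ** (Q ** ?S ** D))" by (rule trace_mul_sym)
  also have "\<dots> = trace (Q' ** D)"
    by (simp add: Q'_def matrix_mul_assoc)
  also have "\<dots> = (\<Sum>i\<in>UNIV. Q' $ i $ i * D $ i $ i)"
  proof -
    have "(\<Sum>k\<in>UNIV. Q' $ i $ k * D $ k $ i) = (\<Sum>k\<in>UNIV. if k = i then Q' $ i $ i * D $ i $ i else 0)" for i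
      using T(2) by (intro sum.cong) (auto simp: D_def)
    then show ?thesis by (simp add: trace_def matrix_matrix_mult_def)
  qed
  also have "\<dots> \<ge> 0" using pos pos' by (intro sum_nonneg mult_nonneg_nonneg) (auto intro: less_imp_le)
  finally show ?thesis .
qed

text \<open>The tangent bound for the concave function log det at \<open>C\<close>, with
  \<open>J\<close> the inverse of \<open>C\<close>. Once \<open>C\<close> is diagonal, Hadamard's
  inequality for \<open>B\<close> reduces it to \<open>ln t \<le> t - 1\<close> on each diagonal
  entry.\<close>

lemma ln_det_le_trace:
  fixes B C J :: "real^'n^'n"
  assumes B: "posdef B" and C: "posdef C" and J: "J ** C = mat 1"
  shows "ln (det B) \<le> ln (det C) + (trace (B ** J) - CARD('n))"
proof -
  obtain T where T: "det T = 1" "\<And>i j. i \<noteq> j \<Longrightarrow> (T ** C ** transpose T) $ i $ j = 0"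
    using congruence_diagonalization[OF C] by blast
  define D where "D = T ** C ** transpose T"
  define B' where "B' = T ** B ** transpose T"
  have "posdef D" unfolding D_def using C T by (intro posdef_congruence) auto
  note D_pos = posdef_diagonal_pos[OF this]
  have pdB': "posdef B'" unfolding B'_def using B T by (intro posdef_congruence) auto
  note B'_pos = posdef_diagonal_pos[OF this]
  have "det C = det D" using T(1) by (simp add: D_def det_mul)
  also have "\<dots> = (\<Prod>i\<in>UNIV. D $ i $ i)"
    using T(2) unfolding D_def by (rule det_diagonal)
  finally have lnC: "ln (det C) = (\<Sum>i\<in>UNIV. ln (D $ i $ i))"
    by (simp add: ln_prod less_imp_neq[OF D_pos, symmetric])
  have "det B = det B'" using T(1) by (simp add: B'_def det_mul)
  then have "ln (det B) \<le> ln (\<Prod>i\<in>UNIV. B' $ i $ i)"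
    using posdef_det_pos_le[OF pdB'] by simp
  also have "\<dots> = (\<Sum>i\<in>UNIV. ln (B' $ i $ i))"
    using B'_pos by (subst ln_prod) (auto simp: less_imp_neq[symmetric])
  finally have lnB: "ln (det B) \<le> (\<Sum>i\<in>UNIV. ln (B' $ i $ i))" .
  \<comment> \<open>\<open>X\<close> is the inverse of the diagonal matrix \<open>D\<close>, so that
    \<open>J\<close> becomes \<open>transpose T ** X ** T\<close>.\<close>
  define X :: "real^'n^'n" where "X = (\<chi> i j. if i = j then 1 / D $ i $ i else 0)"
  have mulX: "(M ** X) $ i $ j = M $ i $ j / D $ j $ j" for M :: "real^'n^'n" and i j
  proof -
    have "(M ** X) $ i $ j = (\<Sum>k\<in>UNIV. if k = j then M $ i $ j / D $ j $ j else 0)"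
      unfolding matrix_matrix_mult_def vec_lambda_beta by (intro sum.cong) (auto simp: X_def)
    then show ?thesis by simp
  qed
  have "D ** X = mat 1"
    using T(2) D_pos unfolding D_def[symmetric] by (auto simp: vec_eq_iff mulX mat_def less_imp_neq[symmetric])
  then have "T ** (C ** transpose T ** X) = mat 1"
    by (simp add: D_def matrix_mul_assoc)
  then have "C ** (transpose T ** X ** T) = mat 1"
    unfolding matrix_left_right_inverse[of T] by (simp add: matrix_mul_assoc)
  then have J_eq: "J = transpose T ** X ** T"
    using J by (metis matrix_mul_assoc matrix_mul_lid matrix_mul_rid)
  have "trace (B ** J) = trace ((B ** transpose T ** X) ** T)"
    by (simp add: J_eq matrix_mul_assoc)
  also have "\<dots> = trace (T ** (B ** transpose T ** X))" by (rule trace_mul_sym)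
  also have "\<dots> = trace (B' ** X)" by (simp add: B'_def matrix_mul_assoc)
  also have "\<dots> = (\<Sum>i\<in>UNIV. B' $ i $ i / D $ i $ i)" by (simp add: trace_def mulX)
  finally have tr: "trace (B ** J) = \<dots>" .
  have "ln (B' $ i $ i) \<le> ln (D $ i $ i) + (B' $ i $ i / D $ i $ i - 1)" for i
    using ln_le_minus_one[of "B' $ i $ i / D $ i $ i"] B'_pos[of i] D_pos[of i] by (simp add: ln_div)
  then have "(\<Sum>i\<in>UNIV. ln (B' $ i $ i)) \<le> (\<Sum>i\<in>UNIV. ln (D $ i $ i) + (B' $ i $ i / D $ i $ i - 1))"
    by (rule sum_mono)
  with lnB show ?thesis by (simp add: lnC tr sum.distrib sum_subtractf)
qed

section \<open>Comparing a general relay covariance with a multiple of the identity\<close>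

lemma psd_identity_scale: "0 \<le> x \<Longrightarrow> psd (x *\<^sub>R mat 1)"
  by (simp add: psd_def transpose_scalar flip: scaleR_matrix_vector_assoc)

lemma posdef_one_plus_psd:
  assumes "psd C" shows "posdef (mat 1 + C)"
proof -
  have "transpose (mat 1 + C) = mat 1 + C"
    using assms by (simp add: psd_def transpose_def vec_eq_iff mat_def)
  moreover have "0 < x \<bullet> ((mat 1 + C) *v x)" if "x \<noteq> 0" for x
    using assms that unfolding psd_def
    by (simp add: matrix_vector_mult_add_rdistrib inner_add_right add_pos_nonneg)
  ultimately show ?thesis by (simp add: posdef_def)
qed

lemma posdef_gram:
  fixes G :: "real^'n^'m"
  assumes "E ** G = mat 1"
  shows "posdef (transpose G ** G)"
proof -
  have "0 < x \<bullet> (transpose G ** G *v x)" if "x \<noteq> 0" for x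
  proof -
    have "G *v x \<noteq> 0"
      using assms that by (metis matrix_vector_mul_assoc matrix_vector_mul_lid matrix_vector_mult_0_right)
    then have "0 < (G *v x) \<bullet> (G *v x)" by simp
    then show ?thesis
      by (simp add: inner_matrix_vector[of x "transpose G"] del: transpose_matrix_vector flip: matrix_vector_mul_assoc)
  qed
  then show ?thesis by (simp add: posdef_def matrix_transpose_mul)
qed

text \<open>At high signal-to-noise ratio, shaping the covariance gains only O(1/x) over the white
  choice with the same trace budget. The tangent bound is taken at the white covariance, and its
  trace term is evaluated through the resolvent of \<open>transpose G ** G\<close>.\<close>

lemma ln_det_le_identity_covariance:
  fixes G :: "real^'n^'m" and x :: real
  assumes EG: "E ** G = mat 1" and x: "0 < x" and Q: "psd Q" and tr: "trace Q \<le> CARD('n) * x"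
  shows "ln (det (mat 1 + G ** Q ** transpose G)) \<le>
    ln (det (mat 1 + G ** (x *\<^sub>R mat 1) ** transpose G)) + trace (matrix_inv (transpose G ** G)) / x"
proof -
  define A where "A = transpose G ** G"
  define B where "B = mat 1 + G ** Q ** transpose G"
  define C where "C = mat 1 + G ** (x *\<^sub>R mat 1) ** transpose G"
  have pdB: "posdef B" unfolding B_def by (intro posdef_one_plus_psd psd_congruence Q)
  have pdC: "posdef C" unfolding C_def using x by (intro posdef_one_plus_psd psd_congruence psd_identity_scale) simp
  have pdA: "posdef A" unfolding A_def by (rule posdef_gram[OF EG])
  note invA = matrix_inv_inverse[OF posdef_invertible[OF pdA]]
  define J where "J = matrix_inv C"
  have JC: "J ** C = mat 1"
    unfolding J_def by (rule matrix_inv_inverse[OF posdef_invertible[OF pdC]])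
  have C_eq: "C = mat 1 + x *\<^sub>R (G ** transpose G)"
    by (simp add: C_def matrix_scalar_ac flip: scalar_matrix_assoc)
  have J_eq: "J + x *\<^sub>R (J ** G ** transpose G) = mat 1"
    using JC by (simp add: C_eq matrix_add_ldistrib matrix_mul_assoc matrix_scalar_ac flip: scalar_matrix_assoc)
  \<comment> \<open>\<open>Z\<close> is the derivative of log det in the covariance at the white
    point. It is complementary to the resolvent \<open>Y\<close>, as
    \<open>x *\<^sub>R Z + Y = mat 1\<close>, which controls both traces below.\<close>
  define Z where "Z = transpose G ** J ** G"
  define Y where "Y = matrix_inv (mat 1 + x *\<^sub>R A)"
  have "psd (x *\<^sub>R A)" using posdef_imp_psd[OF pdA] x
    by (simp add: psd_def transpose_scalar flip: scaleR_matrix_vector_assoc)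
  then have pdW: "posdef (mat 1 + x *\<^sub>R A)" by (rule posdef_one_plus_psd)
  have pdY: "posdef Y" unfolding Y_def by (intro posdef_inverse pdW)
  note invW = matrix_inv_inverse[OF posdef_invertible[OF pdW], folded Y_def]
  have "Z ** (mat 1 + x *\<^sub>R A) = transpose G ** (J + x *\<^sub>R (J ** G ** transpose G)) ** G"
    by (simp add: Z_def A_def matrix_add_ldistrib matrix_add_rdistrib matrix_mul_assoc
        matrix_scalar_ac flip: scalar_matrix_assoc)
  then have ZW: "Z ** (mat 1 + x *\<^sub>R A) = A" by (simp add: J_eq A_def)
  have "(x *\<^sub>R Z + Y) ** (mat 1 + x *\<^sub>R A) = x *\<^sub>R A + mat 1"
    by (simp add: matrix_add_rdistrib[of "x *\<^sub>R Z"] ZW invW flip: scalar_matrix_assoc)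
  then have "(x *\<^sub>R Z + Y) ** (mat 1 + x *\<^sub>R A) ** Y = (mat 1 + x *\<^sub>R A) ** Y"
    by (simp add: add.commute)
  then have ZY: "x *\<^sub>R Z + Y = mat 1"
    by (simp add: invW flip: matrix_mul_assoc)
  have YA: "x *\<^sub>R Y + matrix_inv A ** Y = matrix_inv A"
  proof -
    have "(matrix_inv A ** (mat 1 + x *\<^sub>R A)) ** Y = matrix_inv A"
      by (simp add: invW flip: matrix_mul_assoc)
    moreover have "matrix_inv A ** (mat 1 + x *\<^sub>R A) = matrix_inv A + x *\<^sub>R mat 1"
      by (simp add: matrix_add_ldistrib invA matrix_scalar_ac flip: scalar_matrix_assoc)
    ultimately show ?thesis
      by (simp add: matrix_add_rdistrib add.commute flip: scalar_matrix_assoc)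
  qed
  have tr_scale: "trace (c *\<^sub>R M) = c * trace M" for c and M :: "real^'k^'k"
    by (simp add: trace_def sum_distrib_left)
  have "x * trace Y + trace (matrix_inv A ** Y) = trace (matrix_inv A)"
    using arg_cong[OF YA, of trace] by (simp add: trace_add tr_scale)
  moreover have "0 \<le> trace (matrix_inv A ** Y)"
    by (intro trace_psd_posdef_nonneg posdef_imp_psd posdef_inverse pdA pdY)
  ultimately have trY: "trace Y \<le> trace (matrix_inv A) / x"
    using x by (simp add: field_simps)
  have trZ: "x * trace Z + trace Y = CARD('n)"
    using arg_cong[OF ZY, of trace] by (simp add: trace_add tr_scale trace_I)
  have "x *\<^sub>R (Q ** Z) + Q ** Y = Q"
    using arg_cong[OF ZY, of "(**) Q"] by (simp add: matrix_add_ldistrib matrix_scalar_ac flip: scalar_matrix_assoc)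
  from arg_cong[OF this, of trace] have "x * trace (Q ** Z) + trace (Q ** Y) = trace Q"
    by (simp add: trace_add tr_scale)
  moreover have "0 \<le> trace (Q ** Y)" by (intro trace_psd_posdef_nonneg Q pdY)
  ultimately have "x * trace (Q ** Z) \<le> x * CARD('n)" using tr by (simp add: mult.commute)
  then have trQZ: "trace (Q ** Z) \<le> CARD('n)" using x by simp
  have "trace (J ** G ** transpose G) = trace Z"
    unfolding Z_def by (subst trace_mul_sym) (simp add: matrix_mul_assoc)
  then have trJ: "trace J + x * trace Z = CARD('m)"
    using arg_cong[OF J_eq, of trace] by (simp add: trace_add tr_scale trace_I)
  have "trace (G ** Q ** transpose G ** J) = trace (Q ** Z)"
  proof -
    have "trace (G ** (Q ** transpose G ** J)) = trace (Q ** transpose G ** J ** G)"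
      by (rule trace_mul_sym)
    then show ?thesis by (simp add: Z_def matrix_mul_assoc)
  qed
  then have "trace (B ** J) = trace J + trace (Q ** Z)"
    by (simp add: B_def matrix_add_rdistrib trace_add)
  \<comment> \<open>Here \<open>trace J = CARD('m) - CARD('n) + trace Y\<close>, and the bound on
    \<open>trace (Q ** Z)\<close> cancels \<open>CARD('n)\<close>, so that only
    \<open>trace Y\<close> survives.\<close>
  then have "trace (B ** J) - CARD('m) \<le> trace (matrix_inv A) / x"
    using trQZ trJ trZ trY by linarith
  then show ?thesis
    using ln_det_le_trace[OF pdB pdC JC] by (simp add: A_def B_def C_def)
qed

section \<open>Rank-one updates and submodularity of log det\<close>

text \<open>The received covariance in units of the noise variance when each relay antenna in
  \<open>S\<close> transmits with signal-to-noise ratio \<open>x\<close> and has channel vector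
  \<open>g n\<close>.\<close>

definition noise_plus :: "real \<Rightarrow> ('n \<Rightarrow> real^'m) \<Rightarrow> 'n set \<Rightarrow> real^'m^'m" where
  "noise_plus x g S = mat 1 + (\<Sum>n\<in>S. x *\<^sub>R outer (g n))"

lemma outer_mult: "outer v *v y = (v \<bullet> y) *\<^sub>R v"
  by (simp add: outer_def vec_eq_iff matrix_vector_mult_def inner_vec_def sum_distrib_left mult_ac)

lemma sum_matrix_vector_mult:
  fixes f :: "'a \<Rightarrow> real^'n^'m"
  shows "(\<Sum>n\<in>S. f n) *v y = (\<Sum>n\<in>S. f n *v y)"
  by (induction S rule: infinite_finite_induct) (simp_all add: matrix_vector_mult_add_rdistrib)

lemma noise_plus_mult: "noise_plus x g S *v y = y + (\<Sum>n\<in>S. (x * (g n \<bullet> y)) *\<^sub>R g n)"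
  by (simp add: noise_plus_def matrix_vector_mult_add_rdistrib sum_matrix_vector_mult outer_mult
      flip: scaleR_matrix_vector_assoc)

lemma noise_plus_form: "y \<bullet> (noise_plus x g S *v y) = y \<bullet> y + x * (\<Sum>n\<in>S. (g n \<bullet> y)\<^sup>2)"
  by (simp add: noise_plus_mult inner_add_right inner_sum_right sum_distrib_left power2_eq_square
      inner_commute mult_ac)

lemma transpose_noise_plus: "transpose (noise_plus x g S) = noise_plus x g S"
  by (auto simp: noise_plus_def outer_def vec_eq_iff transpose_def mat_def mult.commute)

lemma posdef_noise_plus:
  assumes "0 \<le> x" shows "posdef (noise_plus x g S)"
  using assms by (simp add: posdef_def transpose_noise_plus noise_plus_form add_pos_nonneg sum_nonneg)

text \<open>The variational form of the inverse: completing the square around \<open>z\<close>, the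
  image of \<open>v\<close> under the inverse of \<open>C\<close>, leaves the nonnegative form of
  \<open>C\<close> at \<open>y - z\<close>.\<close>

lemma inverse_form_ge:
  fixes C :: "real^'n^'n"
  assumes "posdef C"
  shows "2 * (v \<bullet> y) - y \<bullet> (C *v y) \<le> v \<bullet> (matrix_inv C *v v)"
proof -
  define z where "z = matrix_inv C *v v"
  have Cz: "C *v z = v"
    by (simp add: z_def matrix_vector_mul_assoc matrix_inv_inverse[OF posdef_invertible[OF assms]])
  have sym: "transpose C = C" and psd: "psd C"
    using assms posdef_imp_psd[OF assms] by (simp_all add: posdef_def)
  have "z \<bullet> (C *v y) = v \<bullet> y"
    using inner_matrix_vector[of z C y] by (simp only: sym Cz)
  moreover have "0 \<le> (y - z) \<bullet> (C *v (y - z))" using psd unfolding psd_def by blast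
  ultimately show ?thesis
    by (simp add: matrix_vector_mult_diff_distrib inner_diff Cz inner_commute z_def[symmetric])
qed

text \<open>The variational bound for \<open>C\<close>, tested at the maximizer belonging to
  \<open>D\<close>.\<close>

lemma inverse_form_antimono:
  fixes C D :: "real^'n^'n"
  assumes "posdef C" "posdef D" "\<And>y. y \<bullet> (C *v y) \<le> y \<bullet> (D *v y)"
  shows "v \<bullet> (matrix_inv D *v v) \<le> v \<bullet> (matrix_inv C *v v)"
proof -
  define z where "z = matrix_inv D *v v"
  have "D *v z = v"
    by (simp add: z_def matrix_vector_mul_assoc matrix_inv_inverse[OF posdef_invertible[OF assms(2)]])
  then show ?thesis
    using inverse_form_ge[OF assms(1), of v z] assms(3)[of z]
    by (simp add: z_def[symmetric] inner_commute)
qed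

text \<open>Factoring the old covariance out on the left leaves a rank-one update of the
  identity.\<close>

lemma det_noise_plus_insert:
  fixes g :: "'n::finite \<Rightarrow> real^'m"
  assumes "0 \<le> x" "n \<notin> S"
  shows "det (noise_plus x g (insert n S)) =
    det (noise_plus x g S) * (1 + x * (g n \<bullet> (matrix_inv (noise_plus x g S) *v g n)))"
proof -
  define C where "C = noise_plus x g S"
  define u where "u = x *\<^sub>R (matrix_inv C *v g n)"
  have "invertible C" unfolding C_def by (intro posdef_invertible posdef_noise_plus assms)
  then have "C *v u = x *\<^sub>R g n"
    by (simp add: u_def matrix_vector_mult_scaleR matrix_vector_mul_assoc matrix_inv_inverse)
  then have "(\<Sum>k\<in>UNIV. C $ i $ k * u $ k) = x * g n $ i" for i
    by (metis (no_types) matrix_vector_mult_def vec_lambda_beta vector_scaleR_component real_scaleR_def)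
  then have "C ** (\<chi> i j. u $ i * g n $ j) = x *\<^sub>R outer (g n)"
    by (simp add: vec_eq_iff matrix_matrix_mult_def outer_def mult.assoc[symmetric] flip: sum_distrib_right)
  then have "noise_plus x g (insert n S) = C ** (mat 1 + (\<chi> i j. u $ i * g n $ j))"
    using assms(2) by (simp add: matrix_add_ldistrib C_def noise_plus_def)
  then show ?thesis
    by (simp add: det_mul det_rank_one_update C_def[symmetric]) (simp add: u_def inner_commute)
qed

text \<open>More interference means a smaller inverse form, hence a smaller determinant factor on
  insertion; this is the source of submodularity.\<close>

lemma noise_plus_inverse_form_antimono:
  fixes g :: "'n::finite \<Rightarrow> real^'m"
  assumes "0 \<le> x" "S \<subseteq> T"
  shows "v \<bullet> (matrix_inv (noise_plus x g T) *v v) \<le> v \<bullet> (matrix_inv (noise_plus x g S) *v v)"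
  using assms by (intro inverse_form_antimono posdef_noise_plus)
    (auto simp: noise_plus_form intro!: mult_left_mono sum_mono2)

lemma noise_plus_inverse_form_le:
  fixes g :: "'n::finite \<Rightarrow> real^'m"
  assumes "0 \<le> x"
  shows "v \<bullet> (matrix_inv (noise_plus x g S) *v v) \<le> v \<bullet> v"
proof -
  have e: "noise_plus x g {} = mat 1" by (simp add: noise_plus_def)
  have "matrix_inv (mat 1 :: real^'m^'m) = mat 1"
    using matrix_inv_inverse[of "mat 1 :: real^'m^'m"] by (simp add: invertible_def)
  then show ?thesis using noise_plus_inverse_form_antimono[OF assms, of "{}" S v g] by (simp add: e)
qed

text \<open>A zero-forcing bound: the variational bound is tested at a multiple of \<open>w\<close>,
  which sees none of the vectors in \<open>S\<close>. The result does not depend on \<open>x\<close>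
  or \<open>S\<close>.\<close>

lemma noise_plus_inverse_form_ge:
  fixes g :: "'n::finite \<Rightarrow> real^'m"
  assumes "0 \<le> x" "w \<bullet> g n = 1" "\<And>m. m \<in> S \<Longrightarrow> w \<bullet> g m = 0"
  shows "1 / (w \<bullet> w) \<le> g n \<bullet> (matrix_inv (noise_plus x g S) *v g n)"
proof -
  define s where "s = 1 / (w \<bullet> w)"
  have "w \<bullet> w \<noteq> 0" using assms(2) by auto
  then have "2 * (g n \<bullet> (s *\<^sub>R w)) - (s *\<^sub>R w) \<bullet> (noise_plus x g S *v (s *\<^sub>R w)) = s"
    using assms(2,3) by (simp add: noise_plus_form inner_commute[of "g _"]) (simp add: s_def)
  then show ?thesis
    using inverse_form_ge[OF posdef_noise_plus[OF assms(1)], of "g n" "s *\<^sub>R w" g S] by (simp add: s_def)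
qed



text \<open>The greedy point of a polymatroid. Adding elements in increasing order compares the
  increment over \<open>{..<n}\<close> with that over a subset of it, so submodularity gives the
  inequality.\<close>

lemma chain_increments:
  fixes F :: "'n::{finite,linorder} set \<Rightarrow> real"
  assumes empty: "F {} = 0"
    and submod: "\<And>n S T. S \<subseteq> T \<Longrightarrow> n \<notin> T \<Longrightarrow> F (insert n T) - F T \<le> F (insert n S) - F S"
  shows "(\<Sum>n\<in>S. F {..n} - F {..<n}) \<le> F S"
    and "(\<Sum>n\<in>UNIV. F {..n} - F {..<n}) = F UNIV"
proof -
  have atMost: "{..n} = insert n {..<n}" for n :: 'n by auto
  show "(\<Sum>n\<in>S. F {..n} - F {..<n}) \<le> F S"
  proof (induction S rule: finite_linorder_max_induct[OF finite])
    case 1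
    then show ?case by (simp add: empty)
  next
    case (2 b A)
    then have "b \<notin> A" "A \<subseteq> {..<b}" by auto
    with submod[of A "{..<b}" b] 2 show ?case by (simp add: atMost)
  qed
  \<comment> \<open>Equality is proved for all initial segments, since removing the maximum of one
    leaves another.\<close>
  have "(\<forall>a\<in>S. \<forall>b\<le>a. b \<in> S) \<Longrightarrow> (\<Sum>n\<in>S. F {..n} - F {..<n}) = F S" for S
  proof (induction S rule: finite_linorder_max_induct[OF finite])
    case 1
    then show ?case by (simp add: empty)
  next
    case (2 b A)
    then have "b \<notin> A" "A = {..<b}" by (auto simp: less_le)
    moreover have "(\<Sum>n\<in>A. F {..n} - F {..<n}) = F A"
    proof (rule 2(3), intro ballI allI impI)
      fix a c assume "a \<in> A" "c \<le> a"
      moreover from this have "c \<noteq> b" using 2(2) by auto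
      ultimately show "c \<in> A" using 2(4) by auto
    qed
    ultimately show ?case by (simp add: atMost)
  qed
  then show "(\<Sum>n\<in>UNIV. F {..n} - F {..<n}) = F UNIV" by simp
qed

text \<open>Such an \<open>f\<close> is a point of the base polytope of the log det set function,
  with all coordinates in a prescribed interval.\<close>

definition rate_split :: "real \<Rightarrow> ('n::finite \<Rightarrow> real^'m) \<Rightarrow> real \<Rightarrow> real \<Rightarrow> bool" where
  "rate_split x g l h \<longleftrightarrow> (\<exists>f. (\<forall>S. (\<Sum>n\<in>S. f n) \<le> log 2 (det (noise_plus x g S))) \<and>
    (\<Sum>n\<in>UNIV. f n) = log 2 (det (noise_plus x g UNIV)) \<and> (\<forall>n. l \<le> f n \<and> f n \<le> h))"

lemma rate_split_mono: "rate_split x g l h \<Longrightarrow> l' \<le> l \<Longrightarrow> h \<le> h' \<Longrightarrow> rate_split x g l' h'"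
  unfolding rate_split_def by (meson order_trans)

text \<open>Each increment along the chain is \<open>log 2 (1 + x * q)\<close>. The dual vectors
  \<open>w\<close> bound \<open>q\<close> from below and the norms of \<open>g\<close> bound it from
  above, both uniformly in \<open>x\<close>, so every coordinate grows like
  \<open>log 2 x\<close>.\<close>

lemma rate_splitting:
  fixes g :: "'n::{finite,linorder} \<Rightarrow> real^'m"
  assumes dual: "\<And>n m. w n \<bullet> g m = (if n = m then 1 else 0)"
  obtains c d where "0 < c" "0 < d"
    "\<And>x. 0 < x \<Longrightarrow> rate_split x g (log 2 (c * x)) (log 2 (1 + d * x))"
proof
  \<comment> \<open>The added 1 in \<open>c\<close> and \<open>d\<close> makes both positive without
    spoiling the bounds.\<close>
  define c where "c = 1 / (1 + (\<Sum>n\<in>UNIV. w n \<bullet> w n))"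
  define d where "d = 1 + (\<Sum>n\<in>UNIV. g n \<bullet> g n)"
  have nn: "0 \<le> (\<Sum>n\<in>UNIV. w n \<bullet> w n)" "0 \<le> (\<Sum>n\<in>UNIV. g n \<bullet> g n)" by (auto intro: sum_nonneg)
  then show "0 < c" "0 < d" by (auto simp: c_def d_def)
  fix x :: real assume x: "0 < x"
  define F where "F S = log 2 (det (noise_plus x g S))" for S
  define q where "q n S = g n \<bullet> (matrix_inv (noise_plus x g S) *v g n)" for n S
  have q_mono: "q n T \<le> q n S" if "S \<subseteq> T" for n S T
    unfolding q_def using x that by (intro noise_plus_inverse_form_antimono) auto
  have q_lower: "c \<le> q n S" if "n \<notin> S" for n S
  proof -
    have "w n \<bullet> w n \<le> (\<Sum>n\<in>UNIV. w n \<bullet> w n)" by (intro member_le_sum) auto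
    moreover have "w n \<noteq> 0" using dual[of n n] by auto
    ultimately have "c \<le> 1 / (w n \<bullet> w n)" by (simp add: c_def frac_le)
    also have "\<dots> \<le> q n S"
      unfolding q_def using x that dual by (intro noise_plus_inverse_form_ge) auto
    finally show ?thesis .
  qed
  have q_upper: "q n S \<le> d" for n S
  proof -
    have "q n S \<le> g n \<bullet> g n"
      unfolding q_def using x by (intro noise_plus_inverse_form_le) auto
    also have "\<dots> \<le> (\<Sum>n\<in>UNIV. g n \<bullet> g n)" by (intro member_le_sum) auto
    finally show ?thesis by (simp add: d_def)
  qed
  have q_pos: "0 < q n S" if "n \<notin> S" for n S using q_lower[OF that] \<open>0 < c\<close> by linarith
  have det_pos: "0 < det (noise_plus x g S)" for S
    using x by (intro posdef_det_pos_le posdef_noise_plus) auto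
  have step: "F (insert n S) - F S = log 2 (1 + x * q n S)" if "n \<notin> S" for n S
  proof -
    have "0 < 1 + x * q n S" using x q_pos[OF that] by (simp add: add_pos_pos)
    moreover have "det (noise_plus x g (insert n S)) = det (noise_plus x g S) * (1 + x * q n S)"
      unfolding q_def using x that by (intro det_noise_plus_insert) auto
    ultimately show ?thesis using det_pos[of S] by (simp add: F_def log_mult)
  qed
  have empty: "F {} = 0" by (simp add: F_def noise_plus_def)
  have submod: "F (insert n T) - F T \<le> F (insert n S) - F S" if "S \<subseteq> T" "n \<notin> T" for n S T
  proof -
    have "n \<notin> S" using that by auto
    then show ?thesis using that x q_mono[OF that(1), of n] q_pos[of n T]
      by (simp add: step) (simp add: add_pos_pos)
  qed
  have incr: "log 2 (c * x) \<le> F {..n} - F {..<n}" "F {..n} - F {..<n} \<le> log 2 (1 + d * x)" for n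
  proof -
    have "{..n} = insert n {..<n}" by auto
    then have eq: "F {..n} - F {..<n} = log 2 (1 + x * q n {..<n})" by (simp add: step)
    have "c * x \<le> x * q n {..<n}" "x * q n {..<n} \<le> d * x"
      using q_lower[of n "{..<n}"] q_upper[of n "{..<n}"] x by (simp_all add: mult.commute)
    moreover have "0 < c * x" using x \<open>0 < c\<close> by simp
    ultimately show "log 2 (c * x) \<le> F {..n} - F {..<n}" "F {..n} - F {..<n} \<le> log 2 (1 + d * x)"
      unfolding eq by simp_all
  qed
  show "rate_split x g (log 2 (c * x)) (log 2 (1 + d * x))"
    using chain_increments[of F, OF empty submod] incr
    unfolding rate_split_def by (intro exI[of _ "\<lambda>n. F {..n} - F {..<n}"]) (auto simp: F_def)
qed

section \<open>Feasible rates\<close>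

lemma noise_plus_UNIV:
  fixes G :: "real^'n^'m"
  shows "noise_plus x (\<lambda>n. column n G) UNIV = mat 1 + G ** (x *\<^sub>R mat 1) ** transpose G"
proof -
  have "(\<Sum>n\<in>UNIV. x *\<^sub>R outer (column n G)) = x *\<^sub>R (G ** transpose G)"
    by (simp add: vec_eq_iff outer_def column_def matrix_matrix_mult_def transpose_def sum_distrib_left)
  then show ?thesis by (simp add: noise_plus_def matrix_scalar_ac flip: scalar_matrix_assoc)
qed

lemma noise_plus_scale:
  "mat 1 + (1 / s) *\<^sub>R (\<Sum>n\<in>S. p *\<^sub>R outer (g n)) = noise_plus (p / s) g S"
  by (simp add: noise_plus_def scaleR_sum_right)

text \<open>Some permutation contributes a nonzero term to the determinant. Triangularity forces
  \<open>i \<le> p i\<close>, and only the identity satisfies this.\<close>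

lemma upper_triangular_diagonal_nonzero:
  fixes R :: "((real, 'n::{finite,linorder}) vec, 'n) vec"
  assumes "upper_triangular R" "det R \<noteq> 0"
  shows "R $ n $ n \<noteq> 0"
proof -
  obtain p where p: "p permutes UNIV" "(\<Prod>i\<in>UNIV. R $ i $ p i) \<noteq> 0"
    using assms(2) unfolding det_def by (metis (mono_tags, lifting) mem_Collect_eq mult_zero_right sum.neutral)
  then have nz: "R $ i $ p i \<noteq> 0" for i by simp
  then have ge: "i \<le> p i" for i using assms(1) unfolding upper_triangular_def by (metis leI)
  have "p i = i" for i
  proof (rule ccontr)
    assume "p i \<noteq> i"
    \<comment> \<open>At the largest moved index \<open>m\<close>, the image \<open>p m\<close> lies
      above \<open>m\<close> and is therefore fixed, contradicting injectivity.\<close>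
    define m where "m = Max {i. p i \<noteq> i}"
    have m: "p m \<noteq> m" "\<And>i. p i \<noteq> i \<Longrightarrow> i \<le> m"
      using Max_in[of "{i. p i \<noteq> i}"] \<open>p i \<noteq> i\<close> by (auto simp: m_def)
    then have "p (p m) = p m" using ge[of m] by (metis antisym)
    then show False using m(1) permutes_inj[OF p(1)] by (simp add: inj_eq)
  qed
  then show ?thesis using nz[of n] by simp
qed

text \<open>The rows of a left inverse are dual to the columns of \<open>G k\<close>. For
  \<open>1 \<le> x\<close> the bounds become \<open>log 2 x\<close> plus constants, and finiteness
  of \<open>I\<close> makes the constants common.\<close>

lemma uniform_rate_splitting:
  fixes G :: "'k \<Rightarrow> real^'n::{finite,linorder}^'m"
  assumes I: "finite I" and G: "\<And>k. k \<in> I \<Longrightarrow> \<exists>E. E ** G k = mat 1"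
  obtains u v where
    "\<And>k x. k \<in> I \<Longrightarrow> 1 \<le> x \<Longrightarrow>
      rate_split x (\<lambda>n. column n (G k)) (u + log 2 x) (v + log 2 x)"
proof -
  have ex: "\<exists>u v. \<forall>x\<ge>1. rate_split x (\<lambda>n. column n (G k)) (u + log 2 x) (v + log 2 x)" if k: "k \<in> I" for k
  proof -
    obtain E where E: "E ** G k = mat 1" using G[OF k] by blast
    have "row n E \<bullet> column m (G k) = (if n = m then 1 else 0)" for n m
    proof -
      have "(E ** G k) $ n $ m = row n E \<bullet> column m (G k)"
        by (simp add: matrix_matrix_mult_def row_def column_def inner_vec_def)
      then show ?thesis by (simp add: E mat_def)
    qed
    from rate_splitting[of "\<lambda>n. row n E" "\<lambda>n. column n (G k)", OF this]
    obtain c d where cd: "0 < c" "0 < d" and split: "\<And>x. 0 < x \<Longrightarrow>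
      rate_split x (\<lambda>n. column n (G k)) (log 2 (c * x)) (log 2 (1 + d * x))" by blast
    have "rate_split x (\<lambda>n. column n (G k)) (log 2 c + log 2 x) (log 2 (1 + d) + log 2 x)"
      if x: "1 \<le> x" for x
    proof (rule rate_split_mono[OF split])
      show "log 2 c + log 2 x \<le> log 2 (c * x)" using cd x by (simp add: log_mult)
      have "log 2 (1 + d * x) \<le> log 2 ((1 + d) * x)"
        using cd x by (simp add: distrib_right add_pos_pos)
      then show "log 2 (1 + d * x) \<le> log 2 (1 + d) + log 2 x" using cd x by (simp add: log_mult)
    qed (use x in simp)
    then show ?thesis by blast
  qed
  then obtain u v where uv: "\<And>k x. k \<in> I \<Longrightarrow> 1 \<le> x \<Longrightarrow>
      rate_split x (\<lambda>n. column n (G k)) (u k + log 2 x) (v k + log 2 x)" by metis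
  \<comment> \<open>The inserted 0 keeps \<open>Min\<close> and \<open>Max\<close> meaningful when
    \<open>I\<close> is empty.\<close>
  define u' where "u' = Min (insert 0 (u ` I))"
  define v' where "v' = Max (insert 0 (v ` I))"
  have "u' \<le> u k" "v k \<le> v'" if "k \<in> I" for k
    using I that by (auto simp: u'_def v'_def intro!: Min_le Max_ge)
  then show ?thesis by (intro that[of u' v'] rate_split_mono[OF uv]) auto
qed

section \<open>Logarithmic growth and bounds on the source rates\<close>

lemma eventually_log_le:
  fixes a b :: real
  assumes "a < b"
  shows "\<forall>\<^sub>F P in at_top. a * log 2 P + s \<le> b * log 2 P + t"
proof -
  have "\<forall>\<^sub>F P::real in at_top. (s - t) / (b - a) * ln 2 \<le> ln P"
    using ln_at_top by (simp add: filterlim_at_top)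
  then have "\<forall>\<^sub>F P in at_top. (s - t) / (b - a) \<le> log 2 P"
    by eventually_elim (simp add: log_def le_divide_eq)
  then show ?thesis
  proof eventually_elim
    case (elim P)
    then have "s - t \<le> (b - a) * log 2 P" using assms by (simp add: field_simps)
    then show ?case by (simp add: algebra_simps)
  qed
qed

text \<open>The clipping at 0 rescues monotonicity at \<open>s = 0\<close>, where the convention
  \<open>log 2 0 = 0\<close> exceeds the negative logarithms of small \<open>t\<close>.\<close>

lemma max_log_mono:
  assumes "0 \<le> a" "0 \<le> s" "s \<le> t"
  shows "max (a * log 2 s) 0 \<le> max (a * log 2 t) 0"
proof (cases "s = 0")
  case False
  then have "log 2 s \<le> log 2 t" using assms by simp
  then show ?thesis using assms by (meson max.mono mult_left_mono order_refl)
qed (simp add: log_def)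

lemma src_power_ok_le:
  assumes "src_power_ok K Pk P" "K \<ge> 2" "k \<in> {1..K}"
  shows "P k n \<le> (real K - 1) * Pk k"
proof -
  have nn: "\<And>n. 0 \<le> P k n" using assms by (auto simp: src_power_ok_def)
  have le: "P k n \<le> (\<Sum>n\<in>UNIV. P k n)" using nn by (intro member_le_sum) auto
  have "1 / (real K - 1) * (\<Sum>n\<in>UNIV. P k n) \<le> Pk k"
  proof (cases "k \<in> {1, K}")
    case False
    then have "k \<in> {2..K-1}" using assms by auto
    then have "2 / (real K - 1) * (\<Sum>n\<in>UNIV. P k n) \<le> Pk k"
      using assms by (auto simp: src_power_ok_def)
    moreover have "1 / (real K - 1) * (\<Sum>n\<in>UNIV. P k n) \<le> 2 / (real K - 1) * (\<Sum>n\<in>UNIV. P k n)"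
      using assms nn by (intro mult_right_mono divide_right_mono sum_nonneg) auto
    ultimately show ?thesis by simp
  qed (use assms in \<open>auto simp: src_power_ok_def\<close>)
  then have "(\<Sum>n\<in>UNIV. P k n) \<le> (real K - 1) * Pk k" using assms by (simp add: field_simps)
  then show ?thesis using le by simp
qed

lemma source_rate_le:
  assumes "src_power_ok K Pk P" "K \<ge> 2" "k \<in> {1..K}" "0 < sR" "0 \<le> a"
  shows "max (a * log 2 (\<bar>r\<bar>\<^sup>2 * P k n / sR)) 0 \<le> max (a * log 2 (\<bar>r\<bar>\<^sup>2 * ((real K - 1) * Pk k) / sR)) 0"
proof (rule max_log_mono)
  have "0 \<le> P k n" using assms by (auto simp: src_power_ok_def)
  then show "0 \<le> \<bar>r\<bar>\<^sup>2 * P k n / sR" using assms by simp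
  show "\<bar>r\<bar>\<^sup>2 * P k n / sR \<le> \<bar>r\<bar>\<^sup>2 * ((real K - 1) * Pk k) / sR"
    using assms src_power_ok_le[OF assms(1-3), of n] by (intro divide_right_mono mult_left_mono) auto
qed (use assms in simp)

text \<open>White signalling spends exactly the trace budget, and its relay constraint is the
  distributed one for the full antenna set.\<close>

lemma dist_feasible_imp_coop_feasible:
  fixes G :: "nat \<Rightarrow> real^'n::{finite,linorder}^'m"
  assumes "dist_feasible K \<alpha> r G Pk (\<lambda>_. p) sk sR P R" "0 \<le> p"
  shows "coop_feasible K \<alpha> r G Pk (\<lambda>_. p) sk sR (p *\<^sub>R mat 1) P (\<lambda>k. \<Sum>n\<in>UNIV. R k n)"
proof -
  have R: "0 \<le> R k n" "R k n \<le> 1 / (real K - 1) * max (\<alpha> / 2 * log 2 (\<bar>r k $ n $ n\<bar>\<^sup>2 * P k n / sR)) 0"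
    if "k \<in> {1..K}" for k n
    using assms(1) that unfolding dist_feasible_def by blast+
  have "(\<Sum>n\<in>UNIV. R k n) \<le> 1 / (real K - 1) *
     (\<Sum>n\<in>UNIV. max (\<alpha> / 2 * log 2 (\<bar>r k $ n $ n\<bar>\<^sup>2 * P k n / sR)) 0)" if "k \<in> {1..K}" for k
    unfolding sum_distrib_left using R[OF that] by (intro sum_mono)
  moreover have "(\<Sum>k'\<in>{1..K} - {k}. \<Sum>n\<in>UNIV. R k' n) \<le>
     (1 - \<alpha>) / 2 * log 2 (det (mat 1 + (1 / sk k) *\<^sub>R (G k ** (p *\<^sub>R mat 1) ** transpose (G k))))"
    if "k \<in> {1..K}" for k
  proof -
    have "mat 1 + (1 / sk k) *\<^sub>R (G k ** (p *\<^sub>R mat 1) ** transpose (G k)) =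
      mat 1 + (1 / sk k) *\<^sub>R (\<Sum>n\<in>UNIV. p *\<^sub>R outer (column n (G k)))"
      unfolding noise_plus_scale noise_plus_UNIV by (simp add: matrix_scalar_ac flip: scalar_matrix_assoc)
    moreover have "(\<Sum>n\<in>UNIV. \<Sum>k'\<in>{1..K} - {k}. R k' n) \<le> (1 - \<alpha>) / 2 *
      log 2 (det (mat 1 + (1 / sk k) *\<^sub>R (\<Sum>n\<in>UNIV. p *\<^sub>R outer (column n (G k)))))"
      using assms(1) that unfolding dist_feasible_def by blast
    ultimately show ?thesis by (subst sum.swap) (simp only:)
  qed
  moreover have "trace (p *\<^sub>R mat 1 :: ((real, 'n) vec, 'n) vec) \<le> (\<Sum>n\<in>(UNIV::'n set). p)"
    by (simp add: trace_def mat_def)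
  ultimately show ?thesis
    using assms R by (auto simp: coop_feasible_def dist_feasible_def psd_identity_scale sum_nonneg)
qed

text \<open>A real \<open>Sup\<close> is informative only for bounded sets; the source powers supply
  the bound.\<close>

lemma coop_rates_bdd_above:
  assumes "K \<ge> 2" "0 < sR" "0 \<le> \<alpha>"
  shows "bdd_above {(\<Sum>k\<in>{1..K}. R k) | Q P R. coop_feasible K \<alpha> r G Pk PR sk sR Q P R}"
proof (rule bdd_aboveI, clarify)
  fix Q P R assume f: "coop_feasible K \<alpha> r G Pk PR sk sR Q P R"
  then have ok: "src_power_ok K Pk P" by (simp add: coop_feasible_def)
  show "(\<Sum>k\<in>{1..K}. R k) \<le> (\<Sum>k\<in>{1..K}. 1 / (real K - 1) *
      (\<Sum>n\<in>UNIV. max (\<alpha> / 2 * log 2 (\<bar>r k $ n $ n\<bar>\<^sup>2 * ((real K - 1) * Pk k) / sR)) 0))"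
  proof (rule sum_mono)
    fix k assume k: "k \<in> {1..K}"
    have "R k \<le> 1 / (real K - 1) * (\<Sum>n\<in>UNIV. max (\<alpha> / 2 * log 2 (\<bar>r k $ n $ n\<bar>\<^sup>2 * P k n / sR)) 0)"
      using f k by (auto simp: coop_feasible_def)
    also have "\<dots> \<le> 1 / (real K - 1) *
      (\<Sum>n\<in>UNIV. max (\<alpha> / 2 * log 2 (\<bar>r k $ n $ n\<bar>\<^sup>2 * ((real K - 1) * Pk k) / sR)) 0)"
      using assms k by (intro mult_left_mono sum_mono source_rate_le[OF ok]) auto
    finally show "R k \<le> \<dots>" .
  qed
qed

lemma dist_rates_bdd_above:
  fixes G :: "nat \<Rightarrow> real^'n::{finite,linorder}^'m"
  assumes "K \<ge> 2" "0 < sR" "0 \<le> \<alpha>" "0 \<le> p"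
  shows "bdd_above {(\<Sum>k\<in>{1..K}. \<Sum>n\<in>UNIV. R k n) | P R. dist_feasible K \<alpha> r G Pk (\<lambda>_. p) sk sR P R}"
proof (rule bdd_above_mono[OF coop_rates_bdd_above[OF assms(1-3), of r G Pk "\<lambda>_. p" sk]])
  show "{(\<Sum>k\<in>{1..K}. \<Sum>n\<in>UNIV. R k n) | P R. dist_feasible K \<alpha> r G Pk (\<lambda>_. p) sk sR P R}
    \<subseteq> {(\<Sum>k\<in>{1..K}. R k) | Q P R. coop_feasible K \<alpha> r G Pk (\<lambda>_. p) sk sR Q P R}"
    using dist_feasible_imp_coop_feasible[OF _ assms(4)] by blast
qed

text \<open>Each inserted antenna multiplies the determinant by a factor of at least 1. Hence zero
  rates meet the relay constraints.\<close>

lemma one_le_det_noise_plus: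
  fixes g :: "'n::finite \<Rightarrow> real^'m"
  assumes "0 \<le> x"
  shows "1 \<le> det (noise_plus x g S)"
proof (induction S rule: finite_induct[OF finite])
  case 1
  show ?case by (simp add: noise_plus_def)
next
  case (2 n S)
  have "psd (matrix_inv (noise_plus x g S))"
    by (intro posdef_imp_psd posdef_inverse posdef_noise_plus assms)
  then have "1 \<le> 1 + x * (g n \<bullet> (matrix_inv (noise_plus x g S) *v g n))"
    using assms by (simp add: psd_def)
  with 2 show ?case
    unfolding det_noise_plus_insert[OF assms 2(2)] using mult_mono[of 1 _ 1] by force
qed

lemma R_dist_le_R_coop:
  fixes G :: "nat \<Rightarrow> real^'n::{finite,linorder}^'m"
  assumes "K \<ge> 2" "0 < sR" "0 \<le> \<alpha>" "\<alpha> \<le> 1" "0 \<le> p"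
    and "\<And>k. k \<in> {1..K} \<Longrightarrow> 0 \<le> Pk k" "\<And>k. k \<in> {1..K} \<Longrightarrow> 0 \<le> sk k"
  shows "R_dist K \<alpha> r G Pk (\<lambda>_. p) sk sR \<le> R_coop K \<alpha> r G Pk (\<lambda>_. p) sk sR"
  unfolding R_dist_def R_coop_def
proof (rule cSup_subset_mono)
  have "0 \<le> log 2 (det (noise_plus (p / sk k) (\<lambda>n. column n (G k)) S))" if "k \<in> {1..K}" for k S
  proof -
    have "1 \<le> det (noise_plus (p / sk k) (\<lambda>n. column n (G k)) S)"
      using assms(5) assms(7)[OF that] by (intro one_le_det_noise_plus) simp
    then show ?thesis by (subst zero_le_log_cancel_iff) auto
  qed
  then have "dist_feasible K \<alpha> r G Pk (\<lambda>_. p) sk sR (\<lambda>_ _. 0) (\<lambda>_ _. 0)"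
    using assms by (auto simp: dist_feasible_def noise_plus_scale src_power_ok_def)
  then have "\<exists>P R. dist_feasible K \<alpha> r G Pk (\<lambda>_. p) sk sR P R" by (intro exI)
  then show "{(\<Sum>k\<in>{1..K}. \<Sum>n\<in>UNIV. R k n) | P R. dist_feasible K \<alpha> r G Pk (\<lambda>_. p) sk sR P R} \<noteq> {}"
    by simp
  show "{(\<Sum>k\<in>{1..K}. \<Sum>n\<in>UNIV. R k n) | P R. dist_feasible K \<alpha> r G Pk (\<lambda>_. p) sk sR P R}
    \<subseteq> {(\<Sum>k\<in>{1..K}. R k) | Q P R. coop_feasible K \<alpha> r G Pk (\<lambda>_. p) sk sR Q P R}"
    using dist_feasible_imp_coop_feasible[OF _ assms(5)] by blast
qed (rule coop_rates_bdd_above[OF assms(1-3)])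

section \<open>The two power regimes\<close>

lemma coop_feasible_zero:
  assumes "K \<ge> 2" "\<And>k. k \<in> {1..K} \<Longrightarrow> 0 \<le> Pk k" "\<And>n. 0 \<le> PR n"
  shows "coop_feasible K \<alpha> r G Pk PR sk sR 0 (\<lambda>_ _. 0) (\<lambda>_. 0)"
  using assms by (auto simp: coop_feasible_def src_power_ok_def psd_def transpose_def vec_eq_iff trace_def sum_nonneg)

lemma coop_rates_nonempty:
  assumes "K \<ge> 2" "\<And>k. k \<in> {1..K} \<Longrightarrow> 0 \<le> Pk k" "\<And>n. 0 \<le> PR n"
  shows "{(\<Sum>k\<in>{1..K}. R k) | Q P R. coop_feasible K \<alpha> r G Pk PR sk sR Q P R} \<noteq> {}"
proof -
  have "\<exists>Q P R. coop_feasible K \<alpha> r G Pk PR sk sR Q P R"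
    by (intro exI) (rule coop_feasible_zero[OF assms])
  then show ?thesis by simp
qed

lemma sum_over_others:
  fixes R :: "nat \<Rightarrow> real"
  shows "(\<Sum>k\<in>{1..K}. \<Sum>k'\<in>{1..K} - {k}. R k') = (real K - 1) * (\<Sum>k\<in>{1..K}. R k)"
proof -
  have "(\<Sum>k'\<in>{1..K} - {k}. R k') = (\<Sum>k\<in>{1..K}. R k) - R k" if "k \<in> {1..K}" for k
    using that by (simp add: sum_diff1)
  then have "(\<Sum>k\<in>{1..K}. \<Sum>k'\<in>{1..K} - {k}. R k') = (\<Sum>k\<in>{1..K}. (\<Sum>k\<in>{1..K}. R k) - R k)"
    by (intro sum.cong) auto
  then show ?thesis by (simp add: sum_subtractf algebra_simps)
qed

text \<open>A cooperative solution keeps its powers and has its streams run at full source rate. At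
  high power the relay constraints hold automatically, so no sum rate is lost.\<close>

lemma source_limited:
  fixes G :: "nat \<Rightarrow> real^'n::{finite,linorder}^'m"
  assumes K: "K \<ge> 2" and G: "\<And>k. k \<in> {1..K} \<Longrightarrow> \<exists>E. E ** G k = mat 1"
    and \<beta>: "\<And>k. k \<in> {1..K} \<Longrightarrow> 0 < \<beta> k" "0 < \<beta>R" "0 < \<sigma>2" and \<alpha>: "0 < \<alpha>" "\<alpha> < 1/2"
  shows "\<forall>\<^sub>F p in at_top. R_coop K \<alpha> r G (\<lambda>k. \<beta> k * p) (\<lambda>n. \<beta>R * p) (\<lambda>k. \<sigma>2) \<sigma>2
    \<le> R_dist K \<alpha> r G (\<lambda>k. \<beta> k * p) (\<lambda>n. \<beta>R * p) (\<lambda>k. \<sigma>2) \<sigma>2"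
proof -
  obtain u v where uv: "\<And>k x. k \<in> {1..K} \<Longrightarrow> 1 \<le> x \<Longrightarrow> rate_split x (\<lambda>n. column n (G k)) (u + log 2 x) (v + log 2 x)"
    using uniform_rate_splitting[of "{1..K}" G] G by auto
  \<comment> \<open>\<open>e k n * p\<close> is the largest signal-to-noise ratio that stream
    \<open>n\<close> of source \<open>k\<close> can reach, even with the whole power on it.\<close>
  define e where "e k n = \<bar>r k $ n $ n\<bar>\<^sup>2 * ((real K - 1) * \<beta> k) / \<sigma>2" for k n
  define x where "x p = \<beta>R * p / \<sigma>2" for p
  have ev: "\<forall>\<^sub>F p in at_top. \<forall>k\<in>{1..K}. \<forall>n.
    max (\<alpha> / 2 * log 2 (e k n * p)) 0 \<le> (1 - \<alpha>) / 2 * (u + log 2 (x p))"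
  proof (intro eventually_ball_finite ballI eventually_all_finite)
    fix k n assume k: "k \<in> {1..K}"
    have e: "0 \<le> e k n" using K \<beta>(1)[OF k] \<beta>(3) by (simp add: e_def)
    \<comment> \<open>The first gap is where \<open>\<alpha> < 1/2\<close> enters; the second serves
      the 0 in the maximum and the case \<open>e k n = 0\<close>.\<close>
    have less: "\<alpha> / 2 < (1 - \<alpha>) / 2" "0 < (1 - \<alpha>) / 2" using \<alpha> by auto
    show "\<forall>\<^sub>F p in at_top. max (\<alpha> / 2 * log 2 (e k n * p)) 0 \<le> (1 - \<alpha>) / 2 * (u + log 2 (x p))"
      using eventually_log_le[OF less(1), of "\<alpha> / 2 * log 2 (e k n)" "(1 - \<alpha>) / 2 * (u + log 2 (\<beta>R / \<sigma>2))"]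
        eventually_log_le[OF less(2), of 0 "(1 - \<alpha>) / 2 * (u + log 2 (\<beta>R / \<sigma>2))"]
        eventually_gt_at_top[of 0]
    proof eventually_elim
      case (elim p)
      have x: "log 2 (x p) = log 2 (\<beta>R / \<sigma>2) + log 2 p"
        using elim(3) \<beta> by (simp add: x_def log_mult log_divide)
      \<comment> \<open>A zero diagonal entry of \<open>r k\<close> makes \<open>e k n\<close>
        vanish, and then \<open>log 2 0 = 0\<close> is used.\<close>
      have "\<alpha> / 2 * log 2 (e k n * p) \<le> (1 - \<alpha>) / 2 * (u + log 2 (x p))"
      proof (cases "e k n = 0")
        case True
        then have z: "log 2 (e k n * p) = 0" by (simp only: mult_zero_left) (simp add: log_def)
        show ?thesis using elim(2) unfolding z x by (simp add: algebra_simps)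
      next
        case False
        then have "log 2 (e k n * p) = log 2 (e k n) + log 2 p" using elim(3) e by (simp add: log_mult)
        then show ?thesis using elim(1) \<alpha> by (simp add: x algebra_simps)
      qed
      then show ?case using elim(2) \<alpha> by (simp add: x algebra_simps)
    qed
  qed (use \<alpha> in auto)
  have "\<forall>\<^sub>F p in at_top. \<sigma>2 / \<beta>R \<le> p" by (rule eventually_ge_at_top)
  then have "\<forall>\<^sub>F p in at_top. 1 \<le> x p"
    by eventually_elim (use \<beta> in \<open>simp add: x_def field_simps\<close>)
  with ev eventually_gt_at_top[of 0] show ?thesis
  proof eventually_elim
    case (elim p)
    let ?C = "{(\<Sum>k\<in>{1..K}. R k) | Q P R. coop_feasible K \<alpha> r G (\<lambda>k. \<beta> k * p) (\<lambda>n. \<beta>R * p) (\<lambda>k. \<sigma>2) \<sigma>2 Q P R}"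
    let ?D = "{(\<Sum>k\<in>{1..K}. \<Sum>n\<in>UNIV. R k n) | P R. dist_feasible K \<alpha> r G (\<lambda>k. \<beta> k * p) (\<lambda>n. \<beta>R * p) (\<lambda>k. \<sigma>2) \<sigma>2 P R}"
    have nonneg: "0 \<le> \<beta> k * p" if "k \<in> {1..K}" for k using \<beta>(1)[OF that] elim by simp
    have "0 \<le> \<beta>R * p" using \<beta> elim by simp
    have bdd: "bdd_above ?D" using \<alpha> by (intro dist_rates_bdd_above K \<beta>(3) \<open>0 \<le> \<beta>R * p\<close>) simp
    have ne: "?C \<noteq> {}" by (intro coop_rates_nonempty K nonneg \<open>0 \<le> \<beta>R * p\<close>)
    have "\<exists>d\<in>?D. c \<le> d" if "c \<in> ?C" for c
    proof -
      from that obtain Q P R where c: "c = (\<Sum>k\<in>{1..K}. R k)" and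
        feas: "coop_feasible K \<alpha> r G (\<lambda>k. \<beta> k * p) (\<lambda>n. \<beta>R * p) (\<lambda>k. \<sigma>2) \<sigma>2 Q P R" by blast
      from feas have ok: "src_power_ok K (\<lambda>k. \<beta> k * p) P" by (simp add: coop_feasible_def)
      define R' where "R' k n = 1 / (real K - 1) * max (\<alpha> / 2 * log 2 (\<bar>r k $ n $ n\<bar>\<^sup>2 * P k n / \<sigma>2)) 0" for k n
      have R': "R' k n * (real K - 1) \<le> (1 - \<alpha>) / 2 * (u + log 2 (x p))" if "k \<in> {1..K}" for k n
      proof -
        have "R' k n * (real K - 1) \<le> max (\<alpha> / 2 * log 2 (\<bar>r k $ n $ n\<bar>\<^sup>2 * ((real K - 1) * (\<beta> k * p)) / \<sigma>2)) 0"
          using source_rate_le[OF ok K that \<beta>(3), of "\<alpha> / 2"] \<alpha> K by (simp add: R'_def)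
        also have "\<dots> \<le> (1 - \<alpha>) / 2 * (u + log 2 (x p))"
          using elim(1) that by (simp add: e_def mult.assoc)
        finally show ?thesis .
      qed
      have "(\<Sum>n\<in>S. \<Sum>k'\<in>{1..K} - {k}. R' k' n) \<le> (1 - \<alpha>) / 2 *
          log 2 (det (noise_plus (x p) (\<lambda>n. column n (G k)) S))" if k: "k \<in> {1..K}" for k S
      proof -
        obtain f where f: "(\<Sum>n\<in>S. f n) \<le> log 2 (det (noise_plus (x p) (\<lambda>n. column n (G k)) S))"
          "\<And>n. u + log 2 (x p) \<le> f n" using uv[OF k elim(3)] unfolding rate_split_def by blast
        have "(\<Sum>k'\<in>{1..K} - {k}. R' k' n) \<le> (1 - \<alpha>) / 2 * f n" for n
        proof -
          \<comment> \<open>The relay share of stream \<open>n\<close> is divided evenly among the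
            \<open>K - 1\<close> other sources.\<close>
          have "(\<Sum>k'\<in>{1..K} - {k}. R' k' n) \<le> (\<Sum>k'\<in>{1..K} - {k}. (1 - \<alpha>) / 2 * f n / (real K - 1))"
          proof (rule sum_mono)
            fix k' assume "k' \<in> {1..K} - {k}"
            then have "R' k' n * (real K - 1) \<le> (1 - \<alpha>) / 2 * (u + log 2 (x p))" using R' by blast
            also have "\<dots> \<le> (1 - \<alpha>) / 2 * f n" using f(2) \<alpha> by (intro mult_left_mono) auto
            finally show "R' k' n \<le> (1 - \<alpha>) / 2 * f n / (real K - 1)"
              using K by (subst pos_le_divide_eq) auto
          qed
          also have "\<dots> = (1 - \<alpha>) / 2 * f n"
          proof -
            have card: "real (card ({1..K} - {k})) = real K - 1" using k K by (simp add: of_nat_diff)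
            have "z * (y / z) = y" if "z \<noteq> 0" for y z :: real using that by simp
            note cancel = this
            show ?thesis unfolding sum_constant card by (rule cancel) (use K in simp)
          qed
          finally show ?thesis .
        qed
        then have "(\<Sum>n\<in>S. \<Sum>k'\<in>{1..K} - {k}. R' k' n) \<le> (1 - \<alpha>) / 2 * (\<Sum>n\<in>S. f n)"
          unfolding sum_distrib_left by (rule sum_mono)
        also have "\<dots> \<le> (1 - \<alpha>) / 2 * log 2 (det (noise_plus (x p) (\<lambda>n. column n (G k)) S))"
          using f(1) \<alpha> by (intro mult_left_mono) auto
        finally show ?thesis .
      qed
      then have "dist_feasible K \<alpha> r G (\<lambda>k. \<beta> k * p) (\<lambda>n. \<beta>R * p) (\<lambda>k. \<sigma>2) \<sigma>2 P R'"
        unfolding dist_feasible_def noise_plus_scale x_def[symmetric] using ok K by (auto simp: R'_def)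
      moreover have "c \<le> (\<Sum>k\<in>{1..K}. \<Sum>n\<in>UNIV. R' k n)"
        unfolding c R'_def using feas by (intro sum_mono) (auto simp: coop_feasible_def sum_distrib_left)
      ultimately show ?thesis by blast
    qed
    with ne bdd show ?case unfolding R_coop_def R_dist_def by (rule cSup_mono)
  qed
qed

text \<open>Both optima are compared with the average of the full-antenna relay bounds
  \<open>L k p\<close>: the cooperative one exceeds it by at most \<open>C / p\<close>, and the
  distributed one reaches it.\<close>

lemma relay_limited:
  fixes G :: "nat \<Rightarrow> real^'n::{finite,linorder}^'m"
  assumes K: "K \<ge> 2" and G: "\<And>k. k \<in> {1..K} \<Longrightarrow> \<exists>E. E ** G k = mat 1"
    and r: "\<And>k n. k \<in> {1..K} \<Longrightarrow> r k $ n $ n \<noteq> 0"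
    and \<beta>: "\<And>k. k \<in> {1..K} \<Longrightarrow> 0 < \<beta> k" "0 < \<beta>R" "0 < \<sigma>2" and \<alpha>: "1/2 < \<alpha>" "\<alpha> < 1"
  shows "\<exists>C. \<forall>\<^sub>F p in at_top. R_coop K \<alpha> r G (\<lambda>k. \<beta> k * p) (\<lambda>n. \<beta>R * p) (\<lambda>k. \<sigma>2) \<sigma>2
    \<le> R_dist K \<alpha> r G (\<lambda>k. \<beta> k * p) (\<lambda>n. \<beta>R * p) (\<lambda>k. \<sigma>2) \<sigma>2 + C / p"
proof -
  obtain u v where uv: "\<And>k x. k \<in> {1..K} \<Longrightarrow> 1 \<le> x \<Longrightarrow>
      rate_split x (\<lambda>n. column n (G k)) (u + log 2 x) (v + log 2 x)"
    using uniform_rate_splitting[of "{1..K}" G] G by auto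
  define a where "a = (1 - \<alpha>) / 2"
  define \<kappa> where "\<kappa> = real K - 1"
  define x where "x p = \<beta>R * p / \<sigma>2" for p
  define L where "L k p = log 2 (det (noise_plus (x p) (\<lambda>n. column n (G k)) UNIV))" for k p
  define c where "c k = trace (matrix_inv (transpose (G k) ** G k))" for k
  \<comment> \<open>Equal power on all streams, using up the constraint with factor 2; the end
    sources \<open>1\<close> and \<open>K\<close> then spend half of their budget.\<close>
  define \<epsilon> where "\<epsilon> k = \<beta> k * \<kappa> / (2 * CARD('n))" for k
  define e where "e k n = \<bar>r k $ n $ n\<bar>\<^sup>2 * \<epsilon> k / \<sigma>2" for k n
  have a: "0 < a" "a < \<alpha> / 2" using \<alpha> by (auto simp: a_def)
  have \<kappa>: "1 \<le> \<kappa>" using K by (simp add: \<kappa>_def)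
  have \<epsilon>: "0 < \<epsilon> k" if "k \<in> {1..K}" for k using \<beta>(1)[OF that] \<kappa> by (simp add: \<epsilon>_def)
  have e: "0 < e k n" if "k \<in> {1..K}" for k n using \<beta>(3) \<epsilon>[OF that] r[OF that] by (simp add: e_def)
  have logx: "log 2 (x p) = log 2 (\<beta>R / \<sigma>2) + log 2 p" if "0 < p" for p
    using that \<beta> by (simp add: x_def log_mult log_divide)
  \<comment> \<open>This will make the constructed rates nonnegative: \<open>K / (K - 1)\<close>
    exceeds 1, so it outweighs the constant spread between \<open>u\<close> and
    \<open>v\<close>.\<close>
  have ev1: "\<forall>\<^sub>F p in at_top. v + log 2 (x p) \<le> (\<kappa> + 1) / \<kappa> * (u + log 2 (x p))"
  proof -
    have "1 < (\<kappa> + 1) / \<kappa>" using \<kappa> by simp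
    from eventually_log_le[OF this, of "v + log 2 (\<beta>R / \<sigma>2)" "(\<kappa> + 1) / \<kappa> * (u + log 2 (\<beta>R / \<sigma>2))"]
      eventually_gt_at_top[of 0]
    show ?thesis by eventually_elim (simp add: logx algebra_simps)
  qed
  \<comment> \<open>This will give the source constraints. The leading coefficients of
    \<open>log 2 p\<close> are \<open>a / \<kappa>\<close> and
    \<open>\<alpha> / 2 / \<kappa>\<close>, ordered strictly because
    \<open>1/2 < \<alpha>\<close>.\<close>
  have ev2: "\<forall>\<^sub>F p in at_top. \<forall>k\<in>{1..K}. \<forall>n.
    a * ((\<kappa> + 1) / \<kappa> * (v + log 2 (x p)) - (u + log 2 (x p))) \<le> 1 / \<kappa> * (\<alpha> / 2 * log 2 (e k n * p))"
  proof (intro eventually_ball_finite ballI eventually_all_finite)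
    fix k n assume k: "k \<in> {1..K}"
    have coef: "a * ((\<kappa> + 1) / \<kappa> - 1) = a / \<kappa>" using \<kappa> by (simp add: field_simps)
    have "a / \<kappa> < \<alpha> / 2 / \<kappa>" using a \<kappa> by (intro divide_strict_right_mono) auto
    from eventually_log_le[OF this, of "a * ((\<kappa> + 1) / \<kappa> * (v + log 2 (\<beta>R / \<sigma>2)) - (u + log 2 (\<beta>R / \<sigma>2)))"
        "1 / \<kappa> * (\<alpha> / 2 * log 2 (e k n))"] eventually_gt_at_top[of 0]
    show "\<forall>\<^sub>F p in at_top. a * ((\<kappa> + 1) / \<kappa> * (v + log 2 (x p)) - (u + log 2 (x p)))
      \<le> 1 / \<kappa> * (\<alpha> / 2 * log 2 (e k n * p))"
    proof eventually_elim
      case (elim p)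
      have "a * ((\<kappa> + 1) / \<kappa> * (v + log 2 (x p)) - (u + log 2 (x p))) =
        a * ((\<kappa> + 1) / \<kappa> - 1) * log 2 p + a * ((\<kappa> + 1) / \<kappa> * (v + log 2 (\<beta>R / \<sigma>2)) - (u + log 2 (\<beta>R / \<sigma>2)))"
        using elim(2) by (simp add: logx algebra_simps)
      moreover have "1 / \<kappa> * (\<alpha> / 2 * log 2 (e k n * p)) = \<alpha> / 2 / \<kappa> * log 2 p + 1 / \<kappa> * (\<alpha> / 2 * log 2 (e k n))"
        using elim(2) e[OF k, of n] by (simp add: log_mult algebra_simps)
      ultimately show ?case using elim(1) coef by simp
    qed
  qed auto
  have "\<forall>\<^sub>F p in at_top. \<sigma>2 / \<beta>R \<le> p" by (rule eventually_ge_at_top)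
  then have ev3: "\<forall>\<^sub>F p in at_top. 1 \<le> x p"
    by eventually_elim (use \<beta> in \<open>simp add: x_def field_simps\<close>)
  \<comment> \<open>The covariance-shaping gains \<open>c k / (x p * ln 2)\<close>, summed over
    \<open>k\<close> and scaled by \<open>a / \<kappa>\<close>, amount to
    \<open>C / p\<close>.\<close>
  define C where "C = a / \<kappa> * (\<Sum>k\<in>{1..K}. c k) * \<sigma>2 / (\<beta>R * ln 2)"
  from ev1 ev2 ev3 eventually_gt_at_top[of 0]
  have "\<forall>\<^sub>F p in at_top. R_coop K \<alpha> r G (\<lambda>k. \<beta> k * p) (\<lambda>n. \<beta>R * p) (\<lambda>k. \<sigma>2) \<sigma>2
    \<le> R_dist K \<alpha> r G (\<lambda>k. \<beta> k * p) (\<lambda>n. \<beta>R * p) (\<lambda>k. \<sigma>2) \<sigma>2 + C / p"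
  proof eventually_elim
    case (elim p)
    let ?C = "{(\<Sum>k\<in>{1..K}. R k) | Q P R. coop_feasible K \<alpha> r G (\<lambda>k. \<beta> k * p) (\<lambda>n. \<beta>R * p) (\<lambda>k. \<sigma>2) \<sigma>2 Q P R}"
    let ?D = "{(\<Sum>k\<in>{1..K}. \<Sum>n\<in>UNIV. R k n) | P R. dist_feasible K \<alpha> r G (\<lambda>k. \<beta> k * p) (\<lambda>n. \<beta>R * p) (\<lambda>k. \<sigma>2) \<sigma>2 P R}"
    have nonneg: "0 \<le> \<beta> k * p" if "k \<in> {1..K}" for k using \<beta>(1)[OF that] elim by simp
    have "0 \<le> \<beta>R * p" using \<beta> elim by simp
    have bdd: "bdd_above ?D" using \<alpha> by (intro dist_rates_bdd_above K \<beta>(3) \<open>0 \<le> \<beta>R * p\<close>) simp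
    have ne: "?C \<noteq> {}" by (intro coop_rates_nonempty K nonneg \<open>0 \<le> \<beta>R * p\<close>)
    have "d \<le> a / \<kappa> * (\<Sum>k\<in>{1..K}. L k p) + C / p" if "d \<in> ?C" for d
    proof -
      from that obtain Q P R where d: "d = (\<Sum>k\<in>{1..K}. R k)" and
        feas: "coop_feasible K \<alpha> r G (\<lambda>k. \<beta> k * p) (\<lambda>n. \<beta>R * p) (\<lambda>k. \<sigma>2) \<sigma>2 Q P R" by blast
      \<comment> \<open>Absorbing the noise variance into the covariance gives the trace bound
        \<open>CARD('n) * x p\<close> of the comparison lemma.\<close>
      define Q' where "Q' = (1 / \<sigma>2) *\<^sub>R Q"
      have Q': "psd Q'" using feas \<beta>(3)
        by (simp add: Q'_def coop_feasible_def psd_def transpose_scalar flip: scaleR_matrix_vector_assoc)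
      have "trace Q' = trace Q / \<sigma>2" by (simp add: Q'_def trace_def sum_divide_distrib)
      then have tr: "trace Q' \<le> CARD('n) * x p"
        using feas \<beta>(3) by (simp add: coop_feasible_def x_def divide_right_mono)
      have "(\<Sum>k'\<in>{1..K} - {k}. R k') \<le> a * (L k p + c k / (x p * ln 2))" if k: "k \<in> {1..K}" for k
      proof -
        obtain E where "E ** G k = mat 1" using G[OF k] by blast
        from ln_det_le_identity_covariance[OF this _ Q' tr]
        have "ln (det (mat 1 + G k ** Q' ** transpose (G k))) \<le>
          ln (det (noise_plus (x p) (\<lambda>n. column n (G k)) UNIV)) + c k / x p"
          using elim(3) by (simp add: noise_plus_UNIV c_def)
        then have "ln (det (mat 1 + G k ** Q' ** transpose (G k))) / ln 2 \<le>
          (ln (det (noise_plus (x p) (\<lambda>n. column n (G k)) UNIV)) + c k / x p) / ln 2"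
          by (rule divide_right_mono) simp
        then have le: "log 2 (det (mat 1 + G k ** Q' ** transpose (G k))) \<le> L k p + c k / (x p * ln 2)"
          by (simp add: L_def log_def add_divide_distrib)
        have "(\<Sum>k'\<in>{1..K} - {k}. R k') \<le>
          a * log 2 (det (mat 1 + (1 / \<sigma>2) *\<^sub>R (G k ** Q ** transpose (G k))))"
          using feas k unfolding coop_feasible_def a_def by blast
        also have "(1 / \<sigma>2) *\<^sub>R (G k ** Q ** transpose (G k)) = G k ** Q' ** transpose (G k)"
          by (simp add: Q'_def matrix_scalar_ac flip: scalar_matrix_assoc)
        also have "a * log 2 (det (mat 1 + G k ** Q' ** transpose (G k))) \<le> a * (L k p + c k / (x p * ln 2))"
          using le a by (intro mult_left_mono) auto
        finally show ?thesis .
      qed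
      \<comment> \<open>Adding all relay constraints counts every rate \<open>\<kappa>\<close>
        times.\<close>
      then have "(\<Sum>k\<in>{1..K}. \<Sum>k'\<in>{1..K} - {k}. R k') \<le> (\<Sum>k\<in>{1..K}. a * (L k p + c k / (x p * ln 2)))"
        by (rule sum_mono)
      then have "\<kappa> * d \<le> a * (\<Sum>k\<in>{1..K}. L k p) + a * (\<Sum>k\<in>{1..K}. c k) / (x p * ln 2)"
        unfolding sum_over_others d
        by (simp add: \<kappa>_def sum.distrib distrib_left sum_distrib_left sum_divide_distrib)
      then have "d \<le> (a * (\<Sum>k\<in>{1..K}. L k p) + a * (\<Sum>k\<in>{1..K}. c k) / (x p * ln 2)) / \<kappa>"
        using \<kappa> by (simp add: le_divide_eq mult.commute)
      also have "\<dots> = a / \<kappa> * (\<Sum>k\<in>{1..K}. L k p) + C / p"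
        using \<kappa> \<beta> elim(4) by (simp add: C_def x_def field_simps)
      finally show ?thesis .
    qed
    then have upper: "Sup ?C \<le> a / \<kappa> * (\<Sum>k\<in>{1..K}. L k p) + C / p"
      using ne by (intro cSup_least)
    have "\<exists>f. (\<forall>S. (\<Sum>n\<in>S. f n) \<le> log 2 (det (noise_plus (x p) (\<lambda>n. column n (G k)) S))) \<and>
      (\<Sum>n\<in>UNIV. f n) = L k p \<and> (\<forall>n. u + log 2 (x p) \<le> f n \<and> f n \<le> v + log 2 (x p))"
      if "k \<in> {1..K}" for k
      using uv[OF that elim(3)] unfolding rate_split_def L_def .
    then obtain f where f: "\<And>k S. k \<in> {1..K} \<Longrightarrow> (\<Sum>n\<in>S. f k n) \<le> log 2 (det (noise_plus (x p) (\<lambda>n. column n (G k)) S))"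
      "\<And>k. k \<in> {1..K} \<Longrightarrow> (\<Sum>n\<in>UNIV. f k n) = L k p"
      "\<And>k n. k \<in> {1..K} \<Longrightarrow> u + log 2 (x p) \<le> f k n"
      "\<And>k n. k \<in> {1..K} \<Longrightarrow> f k n \<le> v + log 2 (x p)"
      by metis
    define F where "F n = (\<Sum>k\<in>{1..K}. f k n)" for n
    \<comment> \<open>The unique solution of \<open>(\<Sum>k'\<noteq>k. R k' n) = a * f k n\<close> for all \<open>k\<close>.\<close>
    define R where "R k n = a * (F n / \<kappa> - f k n)" for k n
    define P where "P k n = \<epsilon> k * p" for k and n :: 'n
    have others: "(\<Sum>k'\<in>{1..K} - {k}. R k' n) = a * f k n" if "k \<in> {1..K}" for k n
    proof -
      have "(\<Sum>k\<in>{1..K}. R k n) = a * ((\<kappa> + 1) * (F n / \<kappa>) - F n)"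
        unfolding R_def sum_distrib_left[symmetric] sum_subtractf F_def[symmetric] by (simp add: \<kappa>_def)
      then have "(\<Sum>k\<in>{1..K}. R k n) = a * (F n / \<kappa>)" using \<kappa> by (simp add: field_simps)
      then show ?thesis using that by (simp add: sum_diff1 R_def algebra_simps)
    qed
    have F_bounds: "(\<kappa> + 1) * (u + log 2 (x p)) \<le> F n" "F n \<le> (\<kappa> + 1) * (v + log 2 (x p))" for n
    proof -
      have "(\<Sum>k\<in>{1..K}. u + log 2 (x p)) \<le> F n" "F n \<le> (\<Sum>k\<in>{1..K}. v + log 2 (x p))"
        unfolding F_def using f(3,4) by (auto intro!: sum_mono simp del: sum_constant)
      then show "(\<kappa> + 1) * (u + log 2 (x p)) \<le> F n" "F n \<le> (\<kappa> + 1) * (v + log 2 (x p))"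
        by (simp_all add: \<kappa>_def)
    qed
    have R_nonneg: "0 \<le> R k n" if k: "k \<in> {1..K}" for k n
    proof -
      have "f k n \<le> (\<kappa> + 1) / \<kappa> * (u + log 2 (x p))" using f(4)[OF k, of n] elim(1) by linarith
      also have "\<dots> \<le> F n / \<kappa>" using F_bounds(1)[of n] \<kappa> by (simp add: divide_right_mono)
      finally show ?thesis using a by (simp add: R_def)
    qed
    have R_le: "R k n \<le> 1 / \<kappa> * max (\<alpha> / 2 * log 2 (\<bar>r k $ n $ n\<bar>\<^sup>2 * P k n / \<sigma>2)) 0"
      if k: "k \<in> {1..K}" for k n
    proof -
      have "F n / \<kappa> \<le> (\<kappa> + 1) / \<kappa> * (v + log 2 (x p))"
        using F_bounds(2)[of n] \<kappa> by (simp add: divide_right_mono)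
      then have "F n / \<kappa> - f k n \<le> (\<kappa> + 1) / \<kappa> * (v + log 2 (x p)) - (u + log 2 (x p))"
        using f(3)[OF k, of n] by linarith
      then have "R k n \<le> a * ((\<kappa> + 1) / \<kappa> * (v + log 2 (x p)) - (u + log 2 (x p)))"
        unfolding R_def using a by (intro mult_left_mono) auto
      also have "\<dots> \<le> 1 / \<kappa> * (\<alpha> / 2 * log 2 (e k n * p))" using elim(2) k by blast
      also have "e k n * p = \<bar>r k $ n $ n\<bar>\<^sup>2 * P k n / \<sigma>2" by (simp add: e_def P_def)
      also have "1 / \<kappa> * (\<alpha> / 2 * log 2 (\<bar>r k $ n $ n\<bar>\<^sup>2 * P k n / \<sigma>2)) \<le>
        1 / \<kappa> * max (\<alpha> / 2 * log 2 (\<bar>r k $ n $ n\<bar>\<^sup>2 * P k n / \<sigma>2)) 0"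
        using \<kappa> by (intro mult_left_mono) auto
      finally show ?thesis .
    qed
    have "src_power_ok K (\<lambda>k. \<beta> k * p) P"
      unfolding src_power_ok_def \<kappa>_def[symmetric]
    proof (intro conjI ballI allI)
      have sums: "2 / \<kappa> * (\<Sum>n\<in>UNIV. P k n) = \<beta> k * p" "1 / \<kappa> * (\<Sum>n\<in>UNIV. P k n) = \<beta> k * p / 2" for k
        using \<kappa> by (simp_all add: P_def \<epsilon>_def)
      show "0 \<le> P k n" if "k \<in> {1..K}" for k n
        using \<epsilon>[OF that] elim(4) by (simp add: P_def)
      show "2 / \<kappa> * (\<Sum>n\<in>UNIV. P k n) \<le> \<beta> k * p" for k
        unfolding sums ..
      show "1 / \<kappa> * (\<Sum>n\<in>UNIV. P k n) \<le> \<beta> k * p" if "k \<in> {1, K}" for k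
      proof -
        have "k \<in> {1..K}" using that K by auto
        from nonneg[OF this] show ?thesis unfolding sums by linarith
      qed
    qed
    moreover have "(\<Sum>n\<in>S. \<Sum>k'\<in>{1..K} - {k}. R k' n) \<le>
      a * log 2 (det (noise_plus (x p) (\<lambda>n. column n (G k)) S))" if "k \<in> {1..K}" for k S
      using f(1)[OF that, of S] a by (simp only: others[OF that] flip: sum_distrib_left) simp
    ultimately have "dist_feasible K \<alpha> r G (\<lambda>k. \<beta> k * p) (\<lambda>n. \<beta>R * p) (\<lambda>k. \<sigma>2) \<sigma>2 P R"
      unfolding dist_feasible_def noise_plus_scale x_def[symmetric] a_def[symmetric] \<kappa>_def[symmetric]
      using R_nonneg R_le by blast
    then have "(\<Sum>k\<in>{1..K}. \<Sum>n\<in>UNIV. R k n) \<le> Sup ?D"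
      by (intro cSup_upper bdd) blast
    \<comment> \<open>Every full-antenna relay constraint is tight, so the same double counting
      gives the sum rate exactly.\<close>
    moreover have "(\<Sum>k\<in>{1..K}. \<Sum>n\<in>UNIV. R k n) = a / \<kappa> * (\<Sum>k\<in>{1..K}. L k p)"
    proof -
      have "(\<Sum>k\<in>{1..K}. L k p) = (\<Sum>k\<in>{1..K}. \<Sum>n\<in>UNIV. f k n)" using f(2) by simp
      then have "a * (\<Sum>k\<in>{1..K}. L k p) = (\<Sum>k\<in>{1..K}. \<Sum>n\<in>UNIV. a * f k n)" by (simp add: sum_distrib_left)
      also have "\<dots> = (\<Sum>k\<in>{1..K}. \<Sum>n\<in>UNIV. \<Sum>k'\<in>{1..K} - {k}. R k' n)"
        by (intro sum.cong refl) (simp only: others)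
      also have "\<dots> = (\<Sum>k\<in>{1..K}. \<Sum>k'\<in>{1..K} - {k}. \<Sum>n\<in>UNIV. R k' n)"
        by (intro sum.cong refl sum.swap)
      also have "\<dots> = \<kappa> * (\<Sum>k\<in>{1..K}. \<Sum>n\<in>UNIV. R k n)"
        unfolding sum_over_others \<kappa>_def ..
      finally show ?thesis using \<kappa> by (simp add: field_simps)
    qed
    ultimately show ?case using upper unfolding R_coop_def R_dist_def by linarith
  qed
  then show ?thesis by blast
qed

section \<open>Squeezing the rate gap in the high-power limit\<close>

theorem theorem2:
  fixes K :: nat and \<alpha> \<sigma>2 \<beta>R :: real and \<beta> :: "nat \<Rightarrow> real"
    and H :: "nat \<Rightarrow> ((real, 'm::finite) vec, 'n::{finite,linorder}) vec"
    and G :: "nat \<Rightarrow> ((real, 'n) vec, 'm) vec"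
    and Rf :: "nat \<Rightarrow> ((real, 'n) vec, 'n) vec" and U :: "nat \<Rightarrow> ((real, 'm) vec, 'n) vec"
  assumes "K \<ge> 2"
    and "CARD('n) \<le> CARD('m)"
    and "\<forall>k\<in>{1..K}. rank (H k) = CARD('n) \<and> rank (G k) = CARD('n)"
    and "\<forall>k\<in>{1..K}. H k = Rf k ** U k \<and> upper_triangular (Rf k) \<and> U k ** transpose (U k) = mat 1"
    and "\<forall>k\<in>{1..K}. \<beta> k > 0" and "\<beta>R > 0" and "\<sigma>2 > 0"
    and "0 < \<alpha>" and "\<alpha> < 1" and "\<alpha> \<noteq> 1/2"
  shows "((\<lambda>P. R_coop K \<alpha> Rf G (\<lambda>k. \<beta> k * P) (\<lambda>n. \<beta>R * P) (\<lambda>k. \<sigma>2) \<sigma>2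
              - R_dist K \<alpha> Rf G (\<lambda>k. \<beta> k * P) (\<lambda>n. \<beta>R * P) (\<lambda>k. \<sigma>2) \<sigma>2) \<longlongrightarrow> 0) at_top"
proof -
  let ?coop = "\<lambda>P. R_coop K \<alpha> Rf G (\<lambda>k. \<beta> k * P) (\<lambda>n. \<beta>R * P) (\<lambda>k. \<sigma>2) \<sigma>2"
  let ?dist = "\<lambda>P. R_dist K \<alpha> Rf G (\<lambda>k. \<beta> k * P) (\<lambda>n. \<beta>R * P) (\<lambda>k. \<sigma>2) \<sigma>2"
  have \<beta>: "\<And>k. k \<in> {1..K} \<Longrightarrow> 0 < \<beta> k" using assms(5) by blast
  have G: "\<exists>E. E ** G k = mat 1" if "k \<in> {1..K}" for k
    using assms(3) that by (simp add: matrix_left_invertible_injective full_rank_injective)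
  have diag: "Rf k $ n $ n \<noteq> 0" if k: "k \<in> {1..K}" for k n
  proof (rule upper_triangular_diagonal_nonzero)
    show "upper_triangular (Rf k)" using assms(4) k by blast
    \<comment> \<open>Full row rank gives \<open>H k\<close> a right inverse; passing it through the
      factorization shows that \<open>Rf k\<close> is invertible.\<close>
    have "\<exists>X. H k ** X = mat 1"
      using assms(3) k by (simp add: matrix_right_invertible_surjective full_rank_surjective)
    then obtain X where "Rf k ** (U k ** X) = mat 1"
      using assms(4) k by (auto simp: matrix_mul_assoc)
    then have "det (Rf k) * det (U k ** X) = 1" by (metis det_I det_mul)
    then show "det (Rf k) \<noteq> 0" by auto
  qed
  have lower: "\<forall>\<^sub>F P in at_top. 0 \<le> ?coop P - ?dist P"
    using eventually_ge_at_top[of 0]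
  proof eventually_elim
    case (elim P)
    have "0 \<le> \<beta> k * P" if "k \<in> {1..K}" for k using \<beta>[OF that] elim by simp
    then have "?dist P \<le> ?coop P"
      using elim \<open>\<beta>R > 0\<close> \<open>\<sigma>2 > 0\<close> \<open>0 < \<alpha>\<close> \<open>\<alpha> < 1\<close>
      by (intro R_dist_le_R_coop \<open>K \<ge> 2\<close>) simp_all
    then show ?case by simp
  qed
  have "\<exists>C. \<forall>\<^sub>F P in at_top. ?coop P \<le> ?dist P + C / P"
  proof (cases "\<alpha> < 1/2")
    case True
    from source_limited[where r = Rf, OF \<open>K \<ge> 2\<close> G \<beta> \<open>\<beta>R > 0\<close> \<open>\<sigma>2 > 0\<close> \<open>0 < \<alpha>\<close> True]
    show ?thesis by (intro exI[of _ 0]) simp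
  next
    case False
    then have "1/2 < \<alpha>" using \<open>\<alpha> \<noteq> 1/2\<close> by simp
    from relay_limited[OF \<open>K \<ge> 2\<close> G diag \<beta> \<open>\<beta>R > 0\<close> \<open>\<sigma>2 > 0\<close> this \<open>\<alpha> < 1\<close>]
    show ?thesis .
  qed
  then obtain C where "\<forall>\<^sub>F P in at_top. ?coop P \<le> ?dist P + C / P" by blast
  then have upper: "\<forall>\<^sub>F P in at_top. ?coop P - ?dist P \<le> C / P"
    by eventually_elim simp
  have "((\<lambda>P. C / P) \<longlongrightarrow> 0) at_top"
    by (rule tendsto_divide_0[OF tendsto_const filterlim_at_top_imp_at_infinity[OF filterlim_ident]])
  then show ?thesis by (rule tendsto_sandwich[OF lower upper tendsto_const])
qed

end
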